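(* Fix a graph $H$, an even integer $m\ge2$, and an edge $e\in E(T_{m,d})$. If $f$ is chosen uniformly at random from $\mathrm{Hom}(T_{m,d},H)$, then $$\Pr(e\text{ is not ideal with respect to }f)\le 2^{-\Omega(d)}.$$
   Context: For $d\ge1$ and even $m\ge 2$, the even discrete torus $T_{m,d}$ is the graph with vertex set $V=\{0,1,\dots,m-1\}^d$ in which two strings are adjacent iff they differ by exactly $1$ (mod $m$) in exactly one coordinate and agree in all others. It is bipartite with classes $\mathcal{E}$ (even coordinate sum) and $\mathcal{O}$ (odd coordinate sum); $N_x$ is the neighborhood of $x$. $H$ is a finite graph without multiple edges, possibly with loops; $\mathrm{Hom}(G,H)$ is the set of maps $f:V(G)\to V(H)$ with $f(u)f(v)\in E(H)$ whenever $uv\in E(G)$. For $A,B\subseteq V(H)$, $A\sim B$ means every vertex of $A$ is adjacent in $H$ to every vertex of $B$. Let $\eta(H)=\max\{|A||B|:A,B\subseteq V(H),A\sim B\}$ and $\mathcal{M}(H)=\{(A,B):A\sim B,|A||B|=\eta(H)\}$. An edge $e=uv$ of $T_{m,d}$ with $u\in\mathcal{E}$ is ideal with respect to $f$ if $f(N_u)=B$ and $f(N_v)=A$ for some $(A,B)\in\mathcal{M}(H)$. $2^{-\Omega(d)}$ denotes a quantity at most $2^{-cd}$ for some constant $c>0$ depending only on $m$ and $H$, for all sufficiently large $d$. *)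

theory Defs
  imports "HOL-Probability.Probability" "Graph_Theory.Pair_Digraph"
begin

text \<open>
  An undirected graph without multiple edges is a symmetric pair digraph; the edge \<open>uv\<close> is
  present as the two arcs \<open>(u, v)\<close> and \<open>(v, u)\<close>.  In particular \<^const>\<open>pair_pseudo_graph\<close> is the
  class of finite graphs without multiple edges, possibly with loops.
\<close>

definition torus :: "nat \<Rightarrow> nat \<Rightarrow> (nat \<Rightarrow> nat) pair_pre_digraph" where
  "torus m d =
     \<lparr> pverts = {..<d} \<rightarrow>\<^sub>E {..<m},
       parcs = {(x, y). x \<in> {..<d} \<rightarrow>\<^sub>E {..<m} \<and> y \<in> {..<d} \<rightarrow>\<^sub>E {..<m} \<and>
         (\<exists>i<d. (y i = (x i + 1) mod m \<or> x i = (y i + 1) mod m) \<and>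
                (\<forall>j<d. j \<noteq> i \<longrightarrow> x j = y j))} \<rparr>"

definition even_class :: "nat \<Rightarrow> nat \<Rightarrow> (nat \<Rightarrow> nat) set" where
  "even_class m d = {x \<in> pverts (torus m d). even (\<Sum>i<d. x i)}"

definition nbhd :: "'a pair_pre_digraph \<Rightarrow> 'a \<Rightarrow> 'a set" where
  "nbhd G x = {y. (x, y) \<in> parcs G}"

text \<open>Homomorphisms are extensional functions, so that they can be counted.\<close>

definition Hom :: "'a pair_pre_digraph \<Rightarrow> 'b pair_pre_digraph \<Rightarrow> ('a \<Rightarrow> 'b) set" where
  "Hom G H = {f \<in> pverts G \<rightarrow>\<^sub>E pverts H. \<forall>u v. (u, v) \<in> parcs G \<longrightarrow> (f u, f v) \<in> parcs H}"

definition fully_adjacent :: "'a pair_pre_digraph \<Rightarrow> 'a set \<Rightarrow> 'a set \<Rightarrow> bool" where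
  "fully_adjacent H A B \<longleftrightarrow> (\<forall>a\<in>A. \<forall>b\<in>B. (a, b) \<in> parcs H)"

definition eta :: "'a pair_pre_digraph \<Rightarrow> nat" where
  "eta H = Max {card A * card B | A B.
     A \<subseteq> pverts H \<and> B \<subseteq> pverts H \<and> fully_adjacent H A B}"

definition max_pairs :: "'a pair_pre_digraph \<Rightarrow> ('a set \<times> 'a set) set" where
  "max_pairs H = {(A, B). A \<subseteq> pverts H \<and> B \<subseteq> pverts H \<and> fully_adjacent H A B \<and>
     card A * card B = eta H}"

text \<open>
  The arc \<open>e\<close> may be either orientation of the edge; \<open>u\<close> is its endpoint in the even class.
\<close>

definition ideal_edge ::
  "nat \<Rightarrow> nat \<Rightarrow> 'a pair_pre_digraph \<Rightarrow> (nat \<Rightarrow> nat) \<times> (nat \<Rightarrow> nat) \<Rightarrow> ((nat \<Rightarrow> nat) \<Rightarrow> 'a) \<Rightarrow> bool"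
where
  "ideal_edge m d H e f \<longleftrightarrow>
     (\<exists>u v. (e = (u, v) \<or> e = (v, u)) \<and> u \<in> even_class m d \<and>
        (\<exists>(A, B) \<in> max_pairs H.
           f ` nbhd (torus m d) u = B \<and> f ` nbhd (torus m d) v = A))"

end

theory Submission
  imports Defs "HOL-Number_Theory.Cong" "HOL-Combinatorics.Permutations"
begin

text \<open>
  Write \<open>S v = f ` N v\<close> and \<open>n(S)\<close> for the common neighbourhood of \<open>S\<close> in \<open>H\<close>.  There are at least \<open>\<eta>\<^bsup>N\<^esup>\<close>
  homomorphisms, \<open>N\<close> being the size of either class, so any subprobability \<open>Q\<close> on them satisfies
  \<open>E [N ln \<eta> + ln Q f] \<le> 0\<close> for uniform \<open>f\<close>.  We take \<open>Q\<close> of the form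
  \<open>\<Prod>v. M v powr (1/\<Delta>) / |n(S v)|\<close>, the product over odd vertices \<open>v\<close>, where \<open>M v\<close> is a mixture, indexed by
  candidates for \<open>S v\<close>, of sequential sampling rules for \<open>f\<close> on \<open>N v\<close>; that \<open>Q\<close> is a subprobability is a
  conditional Shearer inequality.  The even class is revealed by increasing coordinate sum.

  With \<open>S v\<close> known, \<open>f u\<close> for \<open>u \<in> N v\<close> costs at most \<open>ln |S v|\<close>, and \<open>|S v| |n(S v)| \<le> \<eta>\<close>, so every \<open>v\<close>
  for which \<open>(S v, n(S v))\<close> is not a maximal pair yields a constant loss.  If \<open>S v\<close> is not contained in
  \<open>S v'\<close> for another neighbour \<open>v'\<close> of \<open>u\<close>, then \<open>f u \<in> S v \<inter> S v'\<close> costs less than \<open>ln |S v|\<close>; here \<open>S v'\<close> is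
  predicted by the values of \<open>f\<close> on linearly many neighbours of \<open>v'\<close> that precede \<open>u\<close>, and a wrong prediction
  is itself heavily penalised.  The only expense is to announce \<open>S v\<close> to the mixture.  It is predicted by
  \<open>S w\<close> for a lower vertex \<open>w\<close> at bounded distance; a correct prediction costs \<open>exp (- \<Omega>(d)) / \<Delta>\<close>, and an
  incorrect one an arbitrarily small constant.  By the symmetries of the torus the losses therefore
  dominate unless all the bad events have probability \<open>2\<^bsup>- \<Omega>(d)\<^esup>\<close>.
\<close>


section \<open>A conditional Shearer inequality\<close>

text \<open>After each \<open>x v\<close> is normalised to total mass 1, AM-GM bounds the product of
  roots pointwise in \<open>a\<close> by an average, and the averages sum to 1. A vanishing total
  cannot be normalised and is treated first.\<close>

lemma Holder_equal_exponents:
  fixes x :: "'v \<Rightarrow> 'w \<Rightarrow> real"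
  assumes "finite I" "I \<noteq> {}" "finite W" and nonneg: "\<And>v a. v \<in> I \<Longrightarrow> a \<in> W \<Longrightarrow> 0 \<le> x v a"
  shows "(\<Sum>a\<in>W. \<Prod>v\<in>I. x v a powr (1 / card I)) \<le> (\<Prod>v\<in>I. (\<Sum>a\<in>W. x v a) powr (1 / card I))"
proof (cases "\<exists>v\<in>I. (\<Sum>a\<in>W. x v a) = 0")
  case True
  then obtain v where v: "v \<in> I" "(\<Sum>a\<in>W. x v a) = 0" by blast
  then have "x v a = 0" if "a \<in> W" for a
    using that nonneg[of v] assms(3) by (simp add: sum_nonneg_eq_0_iff)
  then have "(\<Prod>v\<in>I. x v a powr (1 / card I)) = 0" if "a \<in> W" for a
    using that v(1) assms(1) by (intro prod_zero) auto
  then have "(\<Sum>a\<in>W. \<Prod>v\<in>I. x v a powr (1 / card I)) = 0" by simp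
  then show ?thesis by (simp add: prod_nonneg)
next
  case False
  define Y where "Y v = (\<Sum>a\<in>W. x v a)" for v
  have Y: "Y v > 0" if "v \<in> I" for v
    using False that nonneg[OF that] sum_nonneg[of W "x v"] unfolding Y_def by fastforce
  have cI: "card I > 0" using assms by (simp add: card_gt_0_iff)
  have "(\<Prod>v\<in>I. x v a powr (1 / card I)) \<le> (\<Prod>v\<in>I. Y v powr (1 / card I)) * (\<Sum>v\<in>I. x v a / Y v / card I)"
    if a: "a \<in> W" for a
  proof -
    have "(\<Prod>v\<in>I. x v a powr (1 / card I)) = (\<Prod>v\<in>I. Y v powr (1 / card I) * (x v a / Y v) powr (1 / card I))"
      using Y nonneg a by (intro prod.cong refl) (simp add: powr_divide less_imp_le less_imp_neq[symmetric])
    also have "\<dots> = (\<Prod>v\<in>I. Y v powr (1 / card I)) * (\<Prod>v\<in>I. (x v a / Y v) powr (1 / card I))"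
      by (simp add: prod.distrib)
    also have "(\<Prod>v\<in>I. (x v a / Y v) powr (1 / card I)) = (\<Prod>v\<in>I. x v a / Y v) powr (1 / card I)"
      by (rule prod_powr_distrib[symmetric])
    also have "\<dots> \<le> (\<Sum>v\<in>I. x v a / Y v / card I)"
      using Y nonneg a assms by (intro arith_geom_mean) (auto simp: less_imp_le)
    finally show ?thesis by (simp add: mult_left_mono prod_nonneg)
  qed
  then have "(\<Sum>a\<in>W. \<Prod>v\<in>I. x v a powr (1 / card I))
    \<le> (\<Sum>a\<in>W. (\<Prod>v\<in>I. Y v powr (1 / card I)) * (\<Sum>v\<in>I. x v a / Y v / card I))"
    by (rule sum_mono)
  also have "\<dots> = (\<Prod>v\<in>I. Y v powr (1 / card I)) * (\<Sum>v\<in>I. \<Sum>a\<in>W. x v a / Y v / card I)"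
    by (subst sum.swap) (simp add: sum_distrib_left)
  also have "(\<Sum>v\<in>I. \<Sum>a\<in>W. x v a / Y v / card I) = (\<Sum>v\<in>I. 1 / card I)"
  proof (intro sum.cong refl)
    fix v assume v: "v \<in> I"
    have "(\<Sum>a\<in>W. x v a / Y v / card I) = (\<Sum>a\<in>W. x v a) / Y v / card I"
      by (simp only: sum_divide_distrib)
    then show "(\<Sum>a\<in>W. x v a / Y v / card I) = 1 / card I"
      using Y[OF v] by (simp flip: Y_def)
  qed
  also have "\<dots> = 1" using cI by simp
  finally show ?thesis by (simp add: Y_def)
qed

text \<open>
  Shearer's entropy inequality \<open>\<Delta> H(X) \<le> (\<Sum>v. H(X_{N v} | past))\<close> in dual form: the conditional entropies are
  replaced by the logarithmic loss of explicit mixtures of kernels.  The coordinates are summed out in order of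
  decreasing level, each by Hoelder's inequality over the \<open>\<Delta>\<close> blocks containing it.
\<close>

lemma conditional_Shearer_mixture:
  fixes lev :: "'u \<Rightarrow> nat" and N :: "'v \<Rightarrow> 'u set" and W :: "'w set"
    and \<pi> :: "'v \<Rightarrow> 'k \<Rightarrow> ('u \<Rightarrow> 'w) \<Rightarrow> real"
    and \<kappa> :: "'v \<Rightarrow> 'k \<Rightarrow> 'u \<Rightarrow> ('u \<Rightarrow> 'w) \<Rightarrow> 'w \<Rightarrow> real"
  assumes fin: "finite E" "finite B" "finite W" and \<Delta>: "0 < \<Delta>"
    and deg: "\<And>u. u \<in> E \<Longrightarrow> card {v \<in> B. u \<in> N v} = \<Delta>"
    and \<pi>0: "\<And>v k f. 0 \<le> \<pi> v k f" and \<pi>1: "\<And>v f. v \<in> B \<Longrightarrow> (\<Sum>k\<in>K. \<pi> v k f) \<le> 1"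
    and \<kappa>0: "\<And>v k u f a. 0 \<le> \<kappa> v k u f a" and \<kappa>1: "\<And>v k u f. v \<in> B \<Longrightarrow> k \<in> K \<Longrightarrow> (\<Sum>a\<in>W. \<kappa> v k u f a) \<le> 1"
    and \<pi>_dep: "\<And>v k f g. v \<in> B \<Longrightarrow> k \<in> K \<Longrightarrow>
       (\<And>x. x \<in> E \<Longrightarrow> (\<And>u. u \<in> N v \<Longrightarrow> lev x < lev u) \<Longrightarrow> f x = g x) \<Longrightarrow> \<pi> v k f = \<pi> v k g"
    and \<kappa>_dep: "\<And>v k u f g. v \<in> B \<Longrightarrow> k \<in> K \<Longrightarrow> u \<in> N v \<Longrightarrow>
       (\<And>x. x \<in> E \<Longrightarrow> lev x < lev u \<Longrightarrow> f x = g x) \<Longrightarrow> \<kappa> v k u f = \<kappa> v k u g"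
    and NE: "\<And>v. v \<in> B \<Longrightarrow> N v \<subseteq> E" and Nne: "\<And>v. v \<in> B \<Longrightarrow> N v \<noteq> {}"
  shows "(\<Sum>f\<in>E \<rightarrow>\<^sub>E W. \<Prod>v\<in>B. (\<Sum>k\<in>K. \<pi> v k f * (\<Prod>u\<in>N v. \<kappa> v k u f (f u))) powr (1 / \<Delta>)) \<le> 1"
proof -
  \<comment> \<open>The mixture as seen once the coordinates in \<open>S\<close> are revealed. An
    untouched block has value 1, which keeps it independent of coordinates that its weights
    \<open>\<pi>\<close> may still read.\<close>
  define M where "M S v f = (if N v \<inter> S = {} then 1 else \<Sum>k\<in>K. \<pi> v k f * (\<Prod>u\<in>N v \<inter> S. \<kappa> v k u f (f u)))"
    for S v f
  have M0: "0 \<le> M S v f" for S v f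
    by (auto simp: M_def \<pi>0 \<kappa>0 intro!: sum_nonneg mult_nonneg_nonneg prod_nonneg)
  have "S \<subseteq> E \<longrightarrow> (\<Sum>f\<in>S \<rightarrow>\<^sub>E W. \<Prod>v\<in>B. M S v f powr (1 / \<Delta>)) \<le> 1" if "finite S" for S
    using that
  \<comment> \<open>Coordinates are inserted by nondecreasing level, so the new \<open>x\<close> has
    maximal level.\<close>
  proof (induction S rule: finite_ranking_induct[where f = lev])
    case empty
    show ?case by (simp add: M_def)
  next
    case (insert x S)
    show ?case
    proof (cases "x \<in> S")
      case True
      then show ?thesis using insert by (simp add: insert_absorb)
    next
      case xS: False
      show ?thesis
      proof
        assume sub: "insert x S \<subseteq> E"
        then have xE: "x \<in> E" and IH: "(\<Sum>f\<in>S \<rightarrow>\<^sub>E W. \<Prod>v\<in>B. M S v f powr (1 / \<Delta>)) \<le> 1"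
          using insert by auto
        define X where "X = {v \<in> B. x \<in> N v}"
        have X: "finite X" "X \<subseteq> B" "card X = \<Delta>" using fin deg[OF xE] by (auto simp: X_def)
        then have Xne: "X \<noteq> {}" using \<Delta> by auto
        have lev: "lev y \<le> lev x" if "y \<in> S" for y using insert(2) that .
        have \<kappa>x: "\<kappa> v k u (f(x := a)) = \<kappa> v k u f" if "v \<in> B" "k \<in> K" "u \<in> N v" "u \<in> insert x S" for v k u f a
          using that lev[of u] by (intro \<kappa>_dep) auto
        \<comment> \<open>\<open>\<pi>\<close> reads only coordinates strictly below the whole
          block. Once the block meets \<open>insert x S\<close>, it has an element of level at most
          \<open>lev x\<close>, so \<open>x\<close> is not among them.\<close>
        have \<pi>x: "\<pi> v k (f(x := a)) = \<pi> v k f" if v: "v \<in> B" "k \<in> K" and ne: "N v \<inter> insert x S \<noteq> {}" for v k f a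
        proof (intro \<pi>_dep v)
          fix y assume *: "\<And>u. u \<in> N v \<Longrightarrow> lev y < lev u"
          obtain u where u: "u \<in> N v" "u \<in> insert x S" using ne by blast
          then have "lev y < lev x" using *[OF u(1)] lev[of u] by auto
          then show "(f(x := a)) y = f y" by auto
        qed
        have out: "M (insert x S) v (f(x := a)) = M S v f" if v: "v \<in> B - X" for v f a
        proof -
          have eq: "N v \<inter> insert x S = N v \<inter> S" using v by (auto simp: X_def)
          show ?thesis
          proof (cases "N v \<inter> S = {}")
            case False
            have "(\<Prod>u\<in>N v \<inter> S. \<kappa> v k u (f(x := a)) ((f(x := a)) u)) = (\<Prod>u\<in>N v \<inter> S. \<kappa> v k u f (f u))"
              if k: "k \<in> K" for k
              using v k xS by (intro prod.cong refl) (auto simp: \<kappa>x)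
            then show ?thesis using False v eq by (auto simp: M_def \<pi>x intro!: sum.cong)
          qed (simp add: M_def eq)
        qed
        \<comment> \<open>Summing over the value at \<open>x\<close> removes one kernel factor. If
          \<open>x\<close> is the first revealed element of its block, only the total weight of
          \<open>\<pi>\<close> is left, which is at most the default value 1.\<close>
        have inn: "(\<Sum>a\<in>W. M (insert x S) v (f(x := a))) \<le> M S v f" if v: "v \<in> X" for v f
        proof -
          have vB: "v \<in> B" "x \<in> N v" using v by (auto simp: X_def)
          have finN: "finite (N v \<inter> S)" using insert by auto
          have eq: "N v \<inter> insert x S = insert x (N v \<inter> S)" using vB by auto
          define R where "R k = (\<Prod>u\<in>N v \<inter> S. \<kappa> v k u f (f u))" for k
          have R0: "0 \<le> R k" for k by (simp add: R_def \<kappa>0 prod_nonneg)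
          have R: "(\<Prod>u\<in>N v \<inter> S. \<kappa> v k u (f(x := a)) ((f(x := a)) u)) = R k" if k: "k \<in> K" for k a
            unfolding R_def using vB k xS by (intro prod.cong refl) (auto simp: \<kappa>x)
          have "(\<Prod>u\<in>insert x (N v \<inter> S). \<kappa> v k u (f(x := a)) ((f(x := a)) u)) = \<kappa> v k x f a * R k"
            if k: "k \<in> K" for k a
            unfolding R[OF k, of a, symmetric] using vB finN xS k by (subst prod.insert) (auto simp: \<kappa>x)
          then have "M (insert x S) v (f(x := a)) = (\<Sum>k\<in>K. \<pi> v k f * (\<kappa> v k x f a * R k))" for a
            using vB unfolding M_def eq by (auto simp: \<pi>x simp del: fun_upd_apply intro!: sum.cong)
          then have "(\<Sum>a\<in>W. M (insert x S) v (f(x := a))) = (\<Sum>k\<in>K. \<pi> v k f * R k * (\<Sum>a\<in>W. \<kappa> v k x f a))"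
            by (simp add: sum.swap[of _ W] sum_distrib_left mult_ac)
          also have "\<dots> \<le> (\<Sum>k\<in>K. \<pi> v k f * R k * 1)"
            using vB by (intro sum_mono mult_left_mono \<kappa>1 mult_nonneg_nonneg \<pi>0 R0) auto
          also have "\<dots> \<le> M S v f"
            using \<pi>1[of v f] vB by (auto simp: M_def R_def)
          finally show ?thesis .
        qed
        have "(\<Sum>f\<in>insert x S \<rightarrow>\<^sub>E W. \<Prod>v\<in>B. M (insert x S) v f powr (1 / \<Delta>))
          = (\<Sum>(a, f)\<in>W \<times> (S \<rightarrow>\<^sub>E W). \<Prod>v\<in>B. M (insert x S) v (f(x := a)) powr (1 / \<Delta>))"
          unfolding PiE_insert_eq
          by (subst sum.reindex[OF inj_combinator[OF xS]]) (auto simp: case_prod_unfold)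
        also have "\<dots> = (\<Sum>f\<in>S \<rightarrow>\<^sub>E W. \<Sum>a\<in>W. \<Prod>v\<in>B. M (insert x S) v (f(x := a)) powr (1 / \<Delta>))"
          by (subst sum.swap) (simp add: sum.cartesian_product)
        also have "\<dots> \<le> (\<Sum>f\<in>S \<rightarrow>\<^sub>E W. \<Prod>v\<in>B. M S v f powr (1 / \<Delta>))"
        proof (rule sum_mono)
          fix f assume "f \<in> S \<rightarrow>\<^sub>E W"
          have split: "(\<Prod>v\<in>B. g v) = (\<Prod>v\<in>B - X. g v) * (\<Prod>v\<in>X. g v)" for g :: "'v \<Rightarrow> real"
            using X fin by (intro prod.subset_diff) auto
          have "(\<Sum>a\<in>W. \<Prod>v\<in>B. M (insert x S) v (f(x := a)) powr (1 / \<Delta>))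
            = (\<Prod>v\<in>B - X. M S v f powr (1 / \<Delta>)) * (\<Sum>a\<in>W. \<Prod>v\<in>X. M (insert x S) v (f(x := a)) powr (1 / \<Delta>))"
            by (simp add: split out sum_distrib_left)
          also have "\<dots> \<le> (\<Prod>v\<in>B - X. M S v f powr (1 / \<Delta>)) * (\<Prod>v\<in>X. M S v f powr (1 / \<Delta>))"
          proof (rule mult_left_mono)
            have "(\<Sum>a\<in>W. \<Prod>v\<in>X. M (insert x S) v (f(x := a)) powr (1 / \<Delta>))
              \<le> (\<Prod>v\<in>X. (\<Sum>a\<in>W. M (insert x S) v (f(x := a))) powr (1 / \<Delta>))"
              using Holder_equal_exponents[OF X(1) Xne fin(3), of "\<lambda>v a. M (insert x S) v (f(x := a))"] X(3) M0 by simp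
            also have "\<dots> \<le> (\<Prod>v\<in>X. M S v f powr (1 / \<Delta>))"
              by (intro prod_mono conjI powr_mono2 inn) (auto intro!: sum_nonneg M0)
            finally show "(\<Sum>a\<in>W. \<Prod>v\<in>X. M (insert x S) v (f(x := a)) powr (1 / \<Delta>)) \<le> (\<Prod>v\<in>X. M S v f powr (1 / \<Delta>))" .
          qed (simp add: prod_nonneg)
          also have "\<dots> = (\<Prod>v\<in>B. M S v f powr (1 / \<Delta>))" by (simp add: split)
          finally show "(\<Sum>a\<in>W. \<Prod>v\<in>B. M (insert x S) v (f(x := a)) powr (1 / \<Delta>)) \<le> (\<Prod>v\<in>B. M S v f powr (1 / \<Delta>))" .
        qed
        also note IH
        finally show "(\<Sum>f\<in>insert x S \<rightarrow>\<^sub>E W. \<Prod>v\<in>B. M (insert x S) v f powr (1 / \<Delta>)) \<le> 1" .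
      qed
    qed
  qed
  then have "(\<Sum>f\<in>E \<rightarrow>\<^sub>E W. \<Prod>v\<in>B. M E v f powr (1 / \<Delta>)) \<le> 1" using fin by blast
  also have "(\<Sum>f\<in>E \<rightarrow>\<^sub>E W. \<Prod>v\<in>B. M E v f powr (1 / \<Delta>))
    = (\<Sum>f\<in>E \<rightarrow>\<^sub>E W. \<Prod>v\<in>B. (\<Sum>k\<in>K. \<pi> v k f * (\<Prod>u\<in>N v. \<kappa> v k u f (f u))) powr (1 / \<Delta>))"
    using NE Nne by (intro sum.cong prod.cong refl) (auto simp: M_def Int_absorb2)
  finally show ?thesis .
qed

lemma card_Collect_disj_le: "card {x \<in> A. P x \<or> Q x} \<le> card {x \<in> A. P x} + card {x \<in> A. Q x}"
  using card_Un_le[of "{x \<in> A. P x}" "{x \<in> A. Q x}"]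
  by (simp add: Un_def conj_disj_distribL flip: Collect_disj_eq)

section \<open>The torus and its symmetries\<close>

locale torus_homs =
  fixes H :: "'a pair_pre_digraph" and m d :: nat
  assumes H: "pair_pseudo_graph H" and m_even: "even m" and m_ge: "2 \<le> m" and d_ge: "3 \<le> d"
begin

abbreviation V :: "(nat \<Rightarrow> nat) set" where "V \<equiv> {..<d} \<rightarrow>\<^sub>E {..<m}"

abbreviation W :: "'a set" where "W \<equiv> pverts H"

abbreviation nb :: "(nat \<Rightarrow> nat) \<Rightarrow> (nat \<Rightarrow> nat) set" where "nb \<equiv> nbhd (torus m d)"

abbreviation \<Omega> :: "((nat \<Rightarrow> nat) \<Rightarrow> 'a) set" where "\<Omega> \<equiv> Hom (torus m d) H"

section \<open>Coordinate steps, neighbourhoods and levels\<close>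

definition up :: "nat \<Rightarrow> (nat \<Rightarrow> nat) \<Rightarrow> nat \<Rightarrow> nat" where "up i x = x(i := (x i + 1) mod m)"

text \<open>Subtraction of one modulo \<open>m\<close>, written as addition of \<open>m - 1\<close>
  so that subtraction of naturals does not truncate at 0. For \<open>m = 2\<close> it agrees with
  \<open>up\<close>.\<close>

definition dn :: "nat \<Rightarrow> (nat \<Rightarrow> nat) \<Rightarrow> nat \<Rightarrow> nat" where "dn i x = x(i := (x i + (m - 1)) mod m)"

definition lev :: "(nat \<Rightarrow> nat) \<Rightarrow> nat" where "lev x = (\<Sum>i<d. x i)"

lemma finite_V: "finite V" by (intro finite_PiE) auto

lemma finite_W: "finite W" using H by (simp add: pair_pseudo_graph_def pair_fin_digraph_def pair_fin_digraph_axioms_def)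

lemma parcs_sym: "(a, b) \<in> parcs H \<Longrightarrow> (b, a) \<in> parcs H"
proof -
  interpret pair_pseudo_graph H by (rule H)
  show "(b, a) \<in> parcs H" if "(a, b) \<in> parcs H"
    using pair_sym_arcs that unfolding symmetric_def by (auto dest: symD)
qed

lemma V_lt: "x \<in> V \<Longrightarrow> i < d \<Longrightarrow> x i < m" by (auto simp: PiE_iff)

lemma upd_V: "x \<in> V \<Longrightarrow> i < d \<Longrightarrow> a < m \<Longrightarrow> x(i := a) \<in> V"
  by (auto simp: PiE_iff extensional_def)

lemma up_V: "x \<in> V \<Longrightarrow> i < d \<Longrightarrow> up i x \<in> V"
  and dn_V: "x \<in> V \<Longrightarrow> i < d \<Longrightarrow> dn i x \<in> V"
  unfolding up_def dn_def using m_ge by (simp_all add: upd_V)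

lemma succ_mod_iff:
  assumes "a < m" "b < m"
  shows "a = (b + 1) mod m \<longleftrightarrow> b = (a + (m - 1)) mod m"
proof -
  have "(b + 1) mod m = (if b = m - 1 then 0 else b + 1)" using assms by auto
  moreover have "(a + (m - 1)) mod m = (if a = 0 then m - 1 else a - 1)"
    using assms by (cases a) auto
  ultimately show ?thesis using assms by auto
qed

lemma up_dn: "x \<in> V \<Longrightarrow> i < d \<Longrightarrow> up i (dn i x) = x"
  and dn_up: "x \<in> V \<Longrightarrow> i < d \<Longrightarrow> dn i (up i x) = x"
  using succ_mod_iff[of "x i" "(x i + (m - 1)) mod m"] succ_mod_iff[of "(x i + 1) mod m" "x i"] V_lt[of x i]
  by (auto simp: up_def dn_def)

lemma nb_eq:
  assumes x: "x \<in> V"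
  shows "nb x = (\<lambda>i. up i x) ` {..<d} \<union> (\<lambda>i. dn i x) ` {..<d}"
proof (intro equalityI subsetI)
  fix y assume "y \<in> nb x"
  then obtain i where y: "y \<in> V" and i: "i < d" "y i = (x i + 1) mod m \<or> x i = (y i + 1) mod m"
    and ne: "\<And>j. j < d \<Longrightarrow> j \<noteq> i \<Longrightarrow> x j = y j"
    by (auto simp: nbhd_def torus_def)
  have "y = x(i := y i)"
  proof
    fix j show "y j = (x(i := y i)) j"
      using ne[of j] x y by (cases "j < d") (auto simp: PiE_iff extensional_def)
  qed
  moreover have "y i = (x i + 1) mod m \<or> y i = (x i + (m - 1)) mod m"
    using i(2) succ_mod_iff[of "x i" "y i"] V_lt[OF x i(1)] V_lt[OF y i(1)] by blast
  ultimately have "y = up i x \<or> y = dn i x" unfolding up_def dn_def by metis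
  then show "y \<in> (\<lambda>i. up i x) ` {..<d} \<union> (\<lambda>i. dn i x) ` {..<d}" using i(1) by auto
next
  fix y assume "y \<in> (\<lambda>i. up i x) ` {..<d} \<union> (\<lambda>i. dn i x) ` {..<d}"
  then obtain i where i: "i < d" and y: "y = up i x \<or> y = dn i x" by auto
  have yV: "y \<in> V" using y up_V[OF x i] dn_V[OF x i] by auto
  have "y i = (x i + 1) mod m \<or> x i = (y i + 1) mod m"
    using y succ_mod_iff[of "x i" "y i"] V_lt[OF x i] V_lt[OF yV i] by (auto simp: up_def dn_def)
  moreover have "x j = y j" if "j \<noteq> i" for j using y that by (auto simp: up_def dn_def)
  ultimately show "y \<in> nb x" using x yV i by (auto simp: nbhd_def torus_def)
qed

lemma up_nb: "x \<in> V \<Longrightarrow> i < d \<Longrightarrow> up i x \<in> nb x"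
  and dn_nb: "x \<in> V \<Longrightarrow> i < d \<Longrightarrow> dn i x \<in> nb x"
  by (auto simp: nb_eq)

lemma nb_V: "nb x \<subseteq> V" by (auto simp: nbhd_def torus_def)

lemma finite_nb: "finite (nb x)" using nb_V finite_V finite_subset by blast

lemma nb_ne: "x \<in> V \<Longrightarrow> nb x \<noteq> {}" using up_nb[of x 0] d_ge by auto

lemma nb_sym: "y \<in> nb x \<longleftrightarrow> x \<in> nb y"
proof -
  have "y \<in> nb x \<Longrightarrow> x \<in> nb y" for x y unfolding nbhd_def torus_def by auto
  then show ?thesis by blast
qed

lemma upd_ne: "a \<noteq> x i \<Longrightarrow> x(i := a) = x(j := b) \<Longrightarrow> i = j"
  by (metis fun_upd_apply)

text \<open>As \<open>m\<close> is even, reduction modulo \<open>m\<close> preserves parity, and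
  adding the odd number \<open>m - 1\<close> changes it.\<close>

lemma dn_ne: "x \<in> V \<Longrightarrow> i < d \<Longrightarrow> (x i + (m - 1)) mod m \<noteq> x i"
proof -
  assume x: "x \<in> V" "i < d"
  then have lt: "x i < m" by (rule V_lt)
  have *: "odd (m - 1)" using m_even m_ge by simp
  have "even ((x i + (m - 1)) mod m) \<longleftrightarrow> even (x i + (m - 1))"
    using m_even by (simp add: dvd_mod_iff)
  then show "(x i + (m - 1)) mod m \<noteq> x i" using * by (metis even_add)
qed

lemma inj_dn: "x \<in> V \<Longrightarrow> inj_on (\<lambda>i. dn i x) {..<d}"
  unfolding inj_on_def dn_def by (metis upd_ne dn_ne lessThan_iff)

lemma card_nb_le: "x \<in> V \<Longrightarrow> card (nb x) \<le> 2 * d"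
  using card_Un_le[of "(\<lambda>i. up i x) ` {..<d}" "(\<lambda>i. dn i x) ` {..<d}"]
    card_image_le[of "{..<d}" "\<lambda>i. up i x"] card_image_le[of "{..<d}" "\<lambda>i. dn i x"]
  by (simp add: nb_eq)

lemma card_nb_ge: "x \<in> V \<Longrightarrow> d \<le> card (nb x)"
  using card_mono[OF finite_nb, of "(\<lambda>i. dn i x) ` {..<d}" x] card_image[OF inj_dn, of x] by (simp add: nb_eq)

lemma lev_upd: "i < d \<Longrightarrow> lev (x(i := a)) + x i = lev x + a"
proof -
  assume i: "i < d"
  have "lev (x(i := a)) = a + (\<Sum>j\<in>{..<d} - {i}. x j)" "lev x = x i + (\<Sum>j\<in>{..<d} - {i}. x j)"
    unfolding lev_def using i by (simp_all add: sum.remove[of _ i])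
  then show ?thesis by simp
qed

lemma lev_dn: "x \<in> V \<Longrightarrow> i < d \<Longrightarrow> 0 < x i \<Longrightarrow> lev x = lev (dn i x) + 1"
  using lev_upd[of i x "x i - 1"] V_lt[of x i] by (cases "x i") (auto simp: dn_def)

lemma nb_upd:
  assumes "x \<in> V" "y \<in> nb x"
  obtains i a where "i < d" "a < m" "y = x(i := a)" "even a \<longleftrightarrow> odd (x i)"
proof -
  have *: "odd (m - 1)" using m_even m_ge by simp
  obtain i where i: "i < d" "y = up i x \<or> y = dn i x" using assms by (auto simp: nb_eq)
  have "even ((x i + 1) mod m) \<longleftrightarrow> even (x i + 1)" "even ((x i + (m - 1)) mod m) \<longleftrightarrow> even (x i + (m - 1))"
    using m_even by (auto simp: dvd_mod_iff)
  then have "even ((x i + 1) mod m) \<longleftrightarrow> odd (x i)" "even ((x i + (m - 1)) mod m) \<longleftrightarrow> odd (x i)"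
    using * by auto
  moreover have "(x i + 1) mod m < m" "(x i + (m - 1)) mod m < m" using m_ge by auto
  ultimately show ?thesis using i that unfolding up_def dn_def by blast
qed

text \<open>A step may wrap around, so the level can jump by up to \<open>m - 1\<close> instead of
  1; parity still alternates because \<open>m\<close> is even.\<close>

lemma lev_nb:
  assumes "x \<in> V" "y \<in> nb x"
  shows "lev y < lev x + m" "lev x < lev y + m" "even (lev y) \<longleftrightarrow> odd (lev x)"
proof -
  obtain i a where i: "i < d" "a < m" "y = x(i := a)" "even a \<longleftrightarrow> odd (x i)"
    using assms by (rule nb_upd)
  have *: "lev y + x i = lev x + a" using lev_upd i by simp
  show "lev y < lev x + m" "lev x < lev y + m" using * i V_lt[OF assms(1) i(1)] by linarith+
  have "even (lev y + x i) \<longleftrightarrow> even (lev x + a)" using * by simp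
  then show "even (lev y) \<longleftrightarrow> odd (lev x)" using i(4) by auto
qed

abbreviation Ev :: "(nat \<Rightarrow> nat) set" where "Ev \<equiv> {x \<in> V. even (lev x)}"
abbreviation Od :: "(nat \<Rightarrow> nat) set" where "Od \<equiv> {x \<in> V. odd (lev x)}"

lemma even_class_eq: "even_class m d = Ev"
  by (simp add: even_class_def torus_def lev_def)

lemma nb_Od: "x \<in> Od \<Longrightarrow> nb x \<subseteq> Ev" and nb_Ev: "x \<in> Ev \<Longrightarrow> nb x \<subseteq> Od"
  using lev_nb(3) nb_V by blast+

text \<open>\<open>up 0\<close> is injective and changes parity, so it injects each class into the
  other.\<close>

lemma card_Ev: "card Ev = card Od"
proof -
  have inj: "inj_on (up 0) V"
    using dn_up d_ge by (intro inj_on_inverseI[where g = "dn 0"]) auto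
  have "up 0 x \<in> nb x" if "x \<in> V" for x using up_nb d_ge that by auto
  then have "up 0 ` Ev \<subseteq> Od" "up 0 ` Od \<subseteq> Ev" using nb_Od nb_Ev by blast+
  moreover have "inj_on (up 0) Ev" "inj_on (up 0) Od" using inj by (auto elim: inj_on_subset)
  ultimately show ?thesis using finite_V by (intro antisym card_inj_on_le[of "up 0"]) auto
qed

lemma card_Od: "2 * card Od = m ^ d"
proof -
  have "card V = card Ev + card Od"
    using finite_V by (subst card_Un_disjoint[symmetric]) (auto intro!: arg_cong[where f = card])
  then show ?thesis using card_Ev by (simp add: card_PiE)
qed

section \<open>Homomorphisms and counts of events\<close>

lemma Hom_iff: "f \<in> \<Omega> \<longleftrightarrow> f \<in> V \<rightarrow>\<^sub>E W \<and> (\<forall>x\<in>V. \<forall>y\<in>nb x. (f x, f y) \<in> parcs H)"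
proof -
  have "parcs (torus m d) = {(x, y). x \<in> V \<and> y \<in> nb x}" by (auto simp: nbhd_def torus_def)
  moreover have "pverts (torus m d) = V" by (simp add: torus_def)
  ultimately show ?thesis unfolding Hom_def by auto
qed

lemma finite_\<Omega>: "finite \<Omega>"
proof (rule finite_subset)
  show "\<Omega> \<subseteq> V \<rightarrow>\<^sub>E W" using Hom_iff by blast
  show "finite (V \<rightarrow>\<^sub>E W)" by (intro finite_PiE finite_V finite_W)
qed

text \<open>The probability of \<open>\<Phi>\<close> under the uniform distribution, scaled by
  \<open>card \<Omega>\<close>; it stays meaningful when \<open>\<Omega>\<close> is empty.\<close>

definition cnt :: "(((nat \<Rightarrow> nat) \<Rightarrow> 'a) \<Rightarrow> bool) \<Rightarrow> nat" where "cnt \<Phi> = card {f \<in> \<Omega>. \<Phi> f}"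

lemma cnt_mono: "(\<And>f. f \<in> \<Omega> \<Longrightarrow> \<Phi> f \<Longrightarrow> \<Psi> f) \<Longrightarrow> cnt \<Phi> \<le> cnt \<Psi>"
  unfolding cnt_def by (intro card_mono) (auto simp: finite_\<Omega>)

lemma cnt_disj: "cnt (\<lambda>f. \<Phi> f \<or> \<Psi> f) \<le> cnt \<Phi> + cnt \<Psi>"
  unfolding cnt_def by (rule card_Collect_disj_le)

lemma cnt_sum: "(\<Sum>f\<in>\<Omega>. of_bool (\<Phi> f)) = real (cnt \<Phi>)"
  unfolding cnt_def by (simp add: finite_\<Omega> Int_def flip: of_nat_sum)

lemma cnt_Bex: "finite I \<Longrightarrow> cnt (\<lambda>f. \<exists>i\<in>I. \<Phi> i f) \<le> (\<Sum>i\<in>I. cnt (\<Phi> i))"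
proof (induction I rule: finite_induct)
  case (insert i I)
  have "cnt (\<lambda>f. \<exists>i\<in>insert i I. \<Phi> i f) \<le> cnt (\<lambda>f. \<Phi> i f \<or> (\<exists>i\<in>I. \<Phi> i f))"
    by (rule cnt_mono) auto
  also have "\<dots> \<le> cnt (\<Phi> i) + cnt (\<lambda>f. \<exists>i\<in>I. \<Phi> i f)" by (rule cnt_disj)
  finally show ?case using insert by simp
qed (simp add: cnt_def)

section \<open>Automorphisms: coordinate permutation, sign 1 or -1, translation\<close>

definition aut :: "nat \<Rightarrow> (nat \<Rightarrow> nat) \<Rightarrow> (nat \<Rightarrow> nat) \<Rightarrow> (nat \<Rightarrow> nat) \<Rightarrow> nat \<Rightarrow> nat" where
  "aut c t p x = (\<lambda>i\<in>{..<d}. (t i + c * x (p i)) mod m)"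

lemma aut_V: "aut c t p x \<in> V" using m_ge by (auto simp: aut_def)

lemma aut_step:
  assumes p: "p permutes {..<d}" and i: "i < d"
  shows "aut c t p (x(p i := (x (p i) + s) mod m)) =
    (aut c t p x)(i := (aut c t p x i + (c * s) mod m) mod m)"
proof
  fix j
  have "p j = p i \<longleftrightarrow> j = i" using permutes_inj[OF p] by (auto simp: inj_def)
  moreover have "(a + c * ((b + s) mod m)) mod m = ((a + c * b) mod m + (c * s) mod m) mod m" for a b
    by (metis add.assoc distrib_left mod_add_eq mod_add_right_eq mod_mult_right_eq)
  ultimately show "aut c t p (x(p i := (x (p i) + s) mod m)) j =
      ((aut c t p x)(i := (aut c t p x i + (c * s) mod m) mod m)) j"
    using i by (auto simp: aut_def)
qed

lemma neg_neg_mod: "((m - 1) * (m - 1)) mod m = 1"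
proof -
  obtain k where "m = k + 2" using m_ge by (metis add.commute le_Suc_ex)
  then have "(m - 1) * (m - 1) = m * k + 1" by (simp add: algebra_simps)
  then have "((m - 1) * (m - 1)) mod m = 1 mod m" by (metis mod_mult_self4)
  then show ?thesis using m_ge by simp
qed

lemma aut_up_dn:
  assumes "p permutes {..<d}" "i < d"
  shows "aut 1 t p (up (p i) x) = up i (aut 1 t p x)" "aut 1 t p (dn (p i) x) = dn i (aut 1 t p x)"
    and "aut (m - 1) t p (up (p i) x) = dn i (aut (m - 1) t p x)"
    and "aut (m - 1) t p (dn (p i) x) = up i (aut (m - 1) t p x)"
  unfolding up_def dn_def aut_step[OF assms] using m_ge by (simp_all add: neg_neg_mod del: One_nat_def)

text \<open>Modulo \<open>m\<close> the multiplier is 1 or -1, hence invertible.\<close>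

lemma aut_inj:
  assumes p: "p permutes {..<d}" and c: "c = 1 \<or> c = m - 1"
  shows "inj_on (aut c t p) V"
proof (rule inj_onI)
  fix x y assume x: "x \<in> V" and y: "y \<in> V" and eq: "aut c t p x = aut c t p y"
  have cop: "coprime c m" using c m_ge coprime_diff_one_left_nat[of m] by (elim disjE) simp_all
  have "x i = y i" if i: "i < d" for i
  proof -
    obtain j where j: "j < d" "p j = i" using permutes_image[OF p] i by (metis imageE lessThan_iff)
    then have "[t j + c * x i = t j + c * y i] (mod m)"
      using fun_cong[OF eq, of j] by (auto simp: aut_def cong_def)
    then have "[x i = y i] (mod m)"
      using cop by (simp add: cong_add_lcancel_nat cong_mult_lcancel_nat)
    then show ?thesis using V_lt x y i by (simp add: cong_def)
  qed
  then show "x = y" using x y by (intro PiE_ext) auto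
qed

lemma aut_image: "p permutes {..<d} \<Longrightarrow> c = 1 \<or> c = m - 1 \<Longrightarrow> aut c t p ` V = V"
  by (rule endo_inj_surj[OF finite_V image_subsetI[OF aut_V] aut_inj])

lemma aut_nb:
  assumes p: "p permutes {..<d}" and c: "c = 1 \<or> c = m - 1" and x: "x \<in> V"
  shows "nb (aut c t p x) = aut c t p ` nb x"
proof -
  have img: "{..<d} = p ` {..<d}" using permutes_image[OF p] by simp
  have R: "aut c t p ` nb x = (\<lambda>i. aut c t p (up (p i) x)) ` {..<d} \<union> (\<lambda>i. aut c t p (dn (p i) x)) ` {..<d}"
    unfolding nb_eq[OF x] by (subst (1 2) img) (simp add: image_Un image_image)
  have L: "nb (aut c t p x) = (\<lambda>i. up i (aut c t p x)) ` {..<d} \<union> (\<lambda>i. dn i (aut c t p x)) ` {..<d}"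
    by (rule nb_eq[OF aut_V])
  have cg: "(\<lambda>i. F i) ` {..<d} = (\<lambda>i. G i) ` {..<d}" if "\<And>i. i < d \<Longrightarrow> F i = G i" for F G :: "nat \<Rightarrow> nat \<Rightarrow> nat"
    using that by (intro image_cong) auto
  show ?thesis
  proof (cases "c = 1")
    case True
    have "(\<lambda>i. aut c t p (up (p i) x)) ` {..<d} = (\<lambda>i. up i (aut c t p x)) ` {..<d}"
      "(\<lambda>i. aut c t p (dn (p i) x)) ` {..<d} = (\<lambda>i. dn i (aut c t p x)) ` {..<d}"
      using aut_up_dn[OF p] True by (auto intro!: cg)
    then show ?thesis unfolding L R by simp
  next
    case False
    then have c: "c = m - 1" using c by simp
    have "(\<lambda>i. aut c t p (up (p i) x)) ` {..<d} = (\<lambda>i. dn i (aut c t p x)) ` {..<d}"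
      "(\<lambda>i. aut c t p (dn (p i) x)) ` {..<d} = (\<lambda>i. up i (aut c t p x)) ` {..<d}"
      using aut_up_dn[OF p] c by (auto intro!: cg)
    then show ?thesis unfolding L R by auto
  qed
qed

text \<open>Precomposition with an automorphism maps the finite set \<open>\<Omega>\<close>
  injectively into itself, so it permutes \<open>\<Omega>\<close> and preserves counts. The
  restriction to \<open>V\<close> keeps the functions extensional.\<close>

lemma cnt_aut:
  assumes p: "p permutes {..<d}" and c: "c = 1 \<or> c = m - 1"
  shows "cnt (\<lambda>f. \<Phi> (restrict (\<lambda>x. f (aut c t p x)) V)) = cnt \<Phi>"
proof -
  define T where "T f = restrict (\<lambda>x. f (aut c t p x)) V" for f :: "(nat \<Rightarrow> nat) \<Rightarrow> 'a"
  have T\<Omega>: "T f \<in> \<Omega>" if f: "f \<in> \<Omega>" for f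
  proof -
    have "(f (aut c t p x), f (aut c t p y)) \<in> parcs H" if "x \<in> V" "y \<in> nb x" for x y
      using f aut_V aut_nb[OF p c that(1)] that by (auto simp: Hom_iff)
    moreover have "f (aut c t p x) \<in> W" for x using f aut_V PiE_mem unfolding Hom_iff by metis
    moreover have "y \<in> V" if "y \<in> nb x" for x y using that nb_V by auto
    ultimately show ?thesis unfolding Hom_iff T_def by simp
  qed
  have inj: "inj_on T \<Omega>"
  proof (rule inj_onI)
    fix f g assume f: "f \<in> \<Omega>" and g: "g \<in> \<Omega>" and eq: "T f = T g"
    have "f y = g y" if y: "y \<in> V" for y
    proof -
      have "y \<in> aut c t p ` V" using aut_image[OF p c] y by simp
      then obtain x where "y = aut c t p x" "x \<in> V" by (rule imageE)
      then show ?thesis using fun_cong[OF eq, of x] by (simp add: T_def)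
    qed
    moreover have "f \<in> V \<rightarrow>\<^sub>E W" "g \<in> V \<rightarrow>\<^sub>E W" using f g unfolding Hom_iff by simp_all
    ultimately show "f = g" by (metis PiE_ext)
  qed
  have img: "T ` \<Omega> = \<Omega>" using T\<Omega> inj by (intro endo_inj_surj finite_\<Omega>) auto
  have "{f \<in> \<Omega>. \<Phi> f} = T ` {f \<in> \<Omega>. \<Phi> (T f)}"
  proof (intro equalityI subsetI)
    fix f assume f: "f \<in> {f \<in> \<Omega>. \<Phi> f}"
    then have "f \<in> T ` \<Omega>" using img by simp
    then obtain g where "f = T g" "g \<in> \<Omega>" by (rule imageE)
    then show "f \<in> T ` {f \<in> \<Omega>. \<Phi> (T f)}" using f by simp
  next
    fix f assume "f \<in> T ` {f \<in> \<Omega>. \<Phi> (T f)}"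
    then obtain g where "f = T g" "g \<in> {f \<in> \<Omega>. \<Phi> (T f)}" by (rule imageE)
    then show "f \<in> {f \<in> \<Omega>. \<Phi> f}" using T\<Omega> by simp
  qed
  then have "cnt \<Phi> = card {f \<in> \<Omega>. \<Phi> (T f)}"
    unfolding cnt_def using inj_on_subset[OF inj, of "{f \<in> \<Omega>. \<Phi> (T f)}"] by (simp add: card_image)
  then show ?thesis by (simp add: cnt_def T_def)
qed

lemma aut_hits:
  assumes "y \<in> V"
  obtains t where "aut c t p x = y"
proof
  have "(y i + (m - (c * x (p i)) mod m) + c * x (p i)) mod m = y i" if i: "i < d" for i
  proof -
    have "(c * x (p i)) mod m < m" using m_ge by simp
    then have "[m - (c * x (p i)) mod m + (c * x (p i)) mod m = 0] (mod m)" by (simp add: cong_def)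
    then have "[m - (c * x (p i)) mod m + (c * x (p i)) = 0] (mod m)" by (simp add: cong_def mod_simps)
    then have "[y i + (m - (c * x (p i)) mod m + c * x (p i)) = y i + 0] (mod m)" by (rule cong_add[OF cong_refl])
    then have "[y i + (m - (c * x (p i)) mod m) + c * x (p i) = y i] (mod m)" by (simp only: add.assoc add_0_right)
    then show ?thesis using V_lt[OF assms i] by (simp only: cong_def mod_less)
  qed
  \<comment> \<open>The translation is \<open>y i - c * x (p i)\<close> modulo \<open>m\<close>,
    shifted by \<open>m\<close> to remain a natural number.\<close>
  then show "aut c (\<lambda>i. y i + (m - (c * x (p i)) mod m)) p x = y"
    using assms by (intro PiE_ext[OF aut_V assms]) (auto simp: aut_def)
qed

lemma image_restrict_aut: "X \<subseteq> V \<Longrightarrow> restrict (\<lambda>x. f (aut c t p x)) V ` X = f ` aut c t p ` X"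
  by (auto simp: image_iff subset_eq)

lemma cnt_nb_translate:
  assumes "x \<in> V" "y \<in> V"
  shows "cnt (\<lambda>f. P (f ` nb x)) = cnt (\<lambda>f. P (f ` nb y))"
proof -
  obtain t where t: "aut 1 t id x = y" using aut_hits[OF assms(2)] by blast
  have "cnt (\<lambda>f. P (f ` nb x)) = cnt (\<lambda>f. P (restrict (\<lambda>x. f (aut 1 t id x)) V ` nb x))"
    by (rule cnt_aut[symmetric]) (auto simp: permutes_id)
  also have "\<dots> = cnt (\<lambda>f. P (f ` nb y))"
    using aut_nb[OF permutes_id _ assms(1), of 1 t] t by (simp only: image_restrict_aut[OF nb_V] simp_thms)
  finally show ?thesis .
qed

lemma card_nb:
  assumes "x \<in> V" "y \<in> V"
  shows "card (nb x) = card (nb y)"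
proof -
  obtain t where t: "aut 1 t id x = y" using aut_hits[OF assms(2)] by blast
  have "inj_on (aut 1 t id) (nb x)" 
    by (rule inj_on_subset[OF aut_inj[OF permutes_id] nb_V]) simp
  then show ?thesis using aut_nb[OF permutes_id _ assms(1), of 1 t] t by (simp add: card_image)
qed

lemma cnt_dn_translate:
  assumes x: "x \<in> V" and y: "y \<in> V" and I: "I \<subseteq> {..<d}"
  shows "cnt (\<lambda>f. f ` (\<lambda>l. dn l x) ` I \<noteq> f ` nb x) = cnt (\<lambda>f. f ` (\<lambda>l. dn l y) ` I \<noteq> f ` nb y)"
proof -
  obtain t where t: "aut 1 t id x = y" using aut_hits[OF y] by blast
  have sub: "(\<lambda>l. dn l x) ` I \<subseteq> V" using dn_V[OF x] I by auto
  have 1: "aut 1 t id ` (\<lambda>l. dn l x) ` I = (\<lambda>l. dn l y) ` I"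
    unfolding image_image using I aut_up_dn(2)[OF permutes_id, of _ t x] t by (intro image_cong) auto
  have 2: "aut 1 t id ` nb x = nb y" using aut_nb[OF permutes_id _ x, of 1 t] t by simp
  have "cnt (\<lambda>f. f ` (\<lambda>l. dn l x) ` I \<noteq> f ` nb x) =
    cnt (\<lambda>f. restrict (\<lambda>x. f (aut 1 t id x)) V ` (\<lambda>l. dn l x) ` I \<noteq> restrict (\<lambda>x. f (aut 1 t id x)) V ` nb x)"
    by (rule cnt_aut[symmetric]) (auto simp: permutes_id)
  also have "\<dots> = cnt (\<lambda>f. f ` (\<lambda>l. dn l y) ` I \<noteq> f ` nb y)"
    by (simp only: image_restrict_aut[OF sub] image_restrict_aut[OF nb_V] 1 2)
  finally show ?thesis .
qed

lemma permutes_two_points: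
  fixes i j i' j' n :: nat
  assumes "i \<noteq> j" "i' \<noteq> j'" "i < n" "j < n" "i' < n" "j' < n"
  obtains p where "p permutes {..<n}" "p i' = i" "p j' = j"
proof -
  \<comment> \<open>The place to which the first transposition sends \<open>j'\<close>; the second
    one moves it to \<open>j\<close> without touching \<open>i\<close>.\<close>
  define j1 where "j1 = Transposition.transpose i' i j'"
  have j1: "j1 \<noteq> i" "j1 < n" using assms by (auto simp: j1_def Transposition.transpose_def)
  define p where "p = Transposition.transpose j1 j \<circ> Transposition.transpose i' i"
  have "p permutes {..<n}" unfolding p_def using assms j1 by (intro permutes_compose permutes_swap_id) auto
  moreover have "p i' = i" "p j' = j" using assms j1 by (auto simp: p_def simp flip: j1_def)
  ultimately show ?thesis using that by blast
qed

text \<open>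
  By symmetry the pair of vertices is immaterial, as long as they differ by one in each of two
  coordinates, both times in the same direction.
\<close>

definition \<beta> :: nat where
  "\<beta> = cnt (\<lambda>f. \<not> f ` nb (\<lambda>i\<in>{..<d}. 0) \<subseteq> f ` nb (dn 0 (dn 1 (\<lambda>i\<in>{..<d}. 0))))"

text \<open>A permutation moves the coordinates \<open>0\<close> and \<open>1\<close> to the chosen
  ones, and a translation moves the base vertex. The multiplier \<open>m - 1\<close> exchanges
  lowering with raising, so one count governs both directions.\<close>

lemma
  assumes y: "y \<in> V" and ij: "i < d" "j < d" "i \<noteq> j"
  shows cnt_dn_dn: "cnt (\<lambda>f. \<not> f ` nb y \<subseteq> f ` nb (dn i (dn j y))) = \<beta>"
    and cnt_up_up: "cnt (\<lambda>f. \<not> f ` nb y \<subseteq> f ` nb (up i (up j y))) = \<beta>"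
proof -
  define x where "x = (\<lambda>i\<in>{..<d}. 0::nat)"
  have x: "x \<in> V" using m_ge by (auto simp: x_def)
  have x': "dn 0 (dn 1 x) \<in> V" using x d_ge by (intro dn_V) auto
  obtain p where p: "p permutes {..<d}" "p i = 0" "p j = 1"
    using permutes_two_points[of 0 1 i j d] ij d_ge by auto
  have *: "\<beta> = cnt (\<lambda>f. \<not> f ` nb (aut c t p x) \<subseteq> f ` nb (aut c t p (dn 0 (dn 1 x))))"
    if c: "c = 1 \<or> c = m - 1" for c t
  proof -
    have "\<beta> = cnt (\<lambda>f. \<not> restrict (\<lambda>x. f (aut c t p x)) V ` nb x \<subseteq>
        restrict (\<lambda>x. f (aut c t p x)) V ` nb (dn 0 (dn 1 x)))"
      unfolding \<beta>_def by (subst cnt_aut[OF p(1) c, symmetric]) (simp add: x_def)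
    then show ?thesis
      by (simp only: image_restrict_aut[OF nb_V] aut_nb[OF p(1) c x] aut_nb[OF p(1) c x'])
  qed
  obtain t where t: "aut 1 t p x = y" using aut_hits[OF y] by blast
  have "aut 1 t p (dn 0 (dn 1 x)) = dn i (dn j y)"
    using aut_up_dn(2)[OF p(1) ij(1), of t] aut_up_dn(2)[OF p(1) ij(2), of t] p t by metis
  then show "cnt (\<lambda>f. \<not> f ` nb y \<subseteq> f ` nb (dn i (dn j y))) = \<beta>" using *[of 1 t] t by simp
  obtain t where t: "aut (m - 1) t p x = y" using aut_hits[OF y] by blast
  have "aut (m - 1) t p (dn 0 (dn 1 x)) = up i (up j y)"
    using aut_up_dn(4)[OF p(1) ij(1), of t] aut_up_dn(4)[OF p(1) ij(2), of t] p t by metis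
  then show "cnt (\<lambda>f. \<not> f ` nb y \<subseteq> f ` nb (up i (up j y))) = \<beta>" using *[of "m - 1" t] t by simp
qed

text \<open>From \<open>z = dn i (dn j y)\<close> one returns to \<open>y\<close> by raising twice,
  so each of the two inclusions fails for exactly \<open>\<beta>\<close> homomorphisms.\<close>

lemma cnt_dn_dn_ne:
  assumes y: "y \<in> V" and ij: "i < d" "j < d" "i \<noteq> j"
  shows "cnt (\<lambda>f. f ` nb y \<noteq> f ` nb (dn i (dn j y))) \<le> 2 * \<beta>"
proof -
  define z where "z = dn i (dn j y)"
  have z: "z \<in> V" using y ij by (simp add: z_def dn_V)
  have yz: "y = up j (up i z)" using y ij by (simp add: z_def up_dn dn_V)
  have "cnt (\<lambda>f. f ` nb y \<noteq> f ` nb z) \<le> cnt (\<lambda>f. \<not> f ` nb y \<subseteq> f ` nb z \<or> \<not> f ` nb z \<subseteq> f ` nb y)"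
    by (rule cnt_mono) auto
  also have "\<dots> \<le> cnt (\<lambda>f. \<not> f ` nb y \<subseteq> f ` nb z) + cnt (\<lambda>f. \<not> f ` nb z \<subseteq> f ` nb y)" by (rule cnt_disj)
  also have "\<dots> = \<beta> + \<beta>"
    using cnt_dn_dn[OF y ij, folded z_def] cnt_up_up[OF z ij(2,1), folded yz] ij(3) by simp
  finally show ?thesis by (simp add: z_def)
qed

text \<open>The list is consumed two coordinates at a time; each of the \<open>n\<close> pairs adds
  at most \<open>2 * \<beta>\<close> by a union bound.\<close>

lemma cnt_fold_dn_ne:
  assumes "y \<in> V" "distinct xs" "set xs \<subseteq> {..<d}" "length xs = 2 * n"
  shows "cnt (\<lambda>f. f ` nb y \<noteq> f ` nb (fold dn xs y)) \<le> 2 * n * \<beta>"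
  using assms
proof (induction n arbitrary: xs y)
  case 0
  then show ?case by (simp add: cnt_def)
next
  case (Suc n)
  then obtain j i ys where xs: "xs = j # i # ys" by (auto simp: length_Suc_conv)
  define z where "z = dn i (dn j y)"
  have z: "z \<in> V" using Suc.prems xs by (simp add: z_def dn_V)
  have "cnt (\<lambda>f. f ` nb y \<noteq> f ` nb (fold dn ys z)) \<le> cnt (\<lambda>f. f ` nb y \<noteq> f ` nb z \<or> f ` nb z \<noteq> f ` nb (fold dn ys z))"
    by (rule cnt_mono) auto
  also have "\<dots> \<le> cnt (\<lambda>f. f ` nb y \<noteq> f ` nb z) + cnt (\<lambda>f. f ` nb z \<noteq> f ` nb (fold dn ys z))" by (rule cnt_disj)
  also have "\<dots> \<le> 2 * \<beta> + 2 * n * \<beta>"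
    using Suc xs z cnt_dn_dn_ne[of y i j] by (intro add_mono Suc.IH) (auto simp: z_def)
  finally show ?case by (simp add: xs z_def algebra_simps)
qed

lemma fold_dn_V: "y \<in> V \<Longrightarrow> set xs \<subseteq> {..<d} \<Longrightarrow> fold dn xs y \<in> V"
  by (induction xs arbitrary: y) (auto simp: dn_V)

text \<open>By distinctness every coordinate is lowered from its original positive value, so none
  wraps around.\<close>

lemma lev_fold_dn:
  assumes "y \<in> V" "distinct xs" "set xs \<subseteq> {..<d}" "\<And>i. i \<in> set xs \<Longrightarrow> 0 < y i"
  shows "lev y = lev (fold dn xs y) + length xs"
  using assms
proof (induction xs arbitrary: y)
  case (Cons i xs)
  have "lev (dn i y) = lev (fold dn xs (dn i y)) + length xs"
    using Cons.prems by (intro Cons.IH) (auto simp: dn_V, auto simp: dn_def)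
  then show ?case using lev_dn[of y i] Cons.prems by simp
qed simp

end

section \<open>Comparison with the uniform distribution\<close>

context torus_homs
begin

section \<open>Common neighbourhoods, maximal pairs and the number of homomorphisms\<close>

definition cn :: "'a set \<Rightarrow> 'a set" where "cn S = {b \<in> W. \<forall>a\<in>S. (a, b) \<in> parcs H}"

text \<open>For \<open>S \<subseteq> W\<close> this says that \<open>(S, cn S)\<close> lies in
  \<open>max_pairs H\<close>.\<close>

definition good :: "'a set \<Rightarrow> bool" where "good S \<longleftrightarrow> card S * card (cn S) = eta H"

text \<open>The degree of the torus. Taking it as a cardinality treats \<open>m = 2\<close>, where
  \<open>up\<close> and \<open>dn\<close> coincide, together with larger \<open>m\<close>.\<close>

definition \<Delta> :: nat where "\<Delta> = card (nb (\<lambda>i\<in>{..<d}. 0))"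

lemma origin_V: "(\<lambda>i\<in>{..<d}. 0) \<in> V" using m_ge by auto

lemma card_nb_\<Delta>: "x \<in> V \<Longrightarrow> card (nb x) = \<Delta>"
  unfolding \<Delta>_def using card_nb origin_V by blast

lemma \<Delta>_ge: "d \<le> \<Delta>" and \<Delta>_le: "\<Delta> \<le> 2 * d"
  unfolding \<Delta>_def using card_nb_ge card_nb_le origin_V by blast+

lemma finite_eta: "finite {card A * card B | A B. A \<subseteq> W \<and> B \<subseteq> W \<and> fully_adjacent H A B}"
  by (rule finite_subset[of _ "(\<lambda>(A, B). card A * card B) ` (Pow W \<times> Pow W)"]) (auto simp: finite_W)

lemma eta_ge: "A \<subseteq> W \<Longrightarrow> B \<subseteq> W \<Longrightarrow> fully_adjacent H A B \<Longrightarrow> card A * card B \<le> eta H"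
  unfolding eta_def by (intro Max_ge finite_eta) blast

lemma eta_attained:
  obtains A B where "A \<subseteq> W" "B \<subseteq> W" "fully_adjacent H A B" "card A * card B = eta H"
proof -
  have "card {} * card {} \<in> {card A * card B | A B. A \<subseteq> W \<and> B \<subseteq> W \<and> fully_adjacent H A B}"
    by (force simp: fully_adjacent_def)
  then have "eta H \<in> {card A * card B | A B. A \<subseteq> W \<and> B \<subseteq> W \<and> fully_adjacent H A B}"
    unfolding eta_def by (intro Max_in finite_eta) blast
  then show ?thesis using that by force
qed

lemma fully_adjacent_sym: "fully_adjacent H A B \<Longrightarrow> fully_adjacent H B A"
  by (auto simp: fully_adjacent_def parcs_sym)

lemma fully_adjacent_cn: "fully_adjacent H S (cn S)"
  by (auto simp: fully_adjacent_def cn_def)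

lemma cn_W: "cn S \<subseteq> W" by (auto simp: cn_def)

text \<open>With \<open>(A, B)\<close> optimal, any choice of values in \<open>A\<close> on even and
  in \<open>B\<close> on odd vertices is a homomorphism, and the two classes have equal
  size.\<close>

lemma card_Hom_ge: "eta H ^ card Od \<le> card \<Omega>"
proof -
  obtain A B where AB: "A \<subseteq> W" "B \<subseteq> W" "fully_adjacent H A B" "card A * card B = eta H"
    by (rule eta_attained)
  define C where "C x = (if even (lev x) then A else B)" for x
  have "eta H ^ card Od = card A ^ card Ev * card B ^ card Od"
    by (simp add: card_Ev power_mult_distrib flip: AB(4))
  also have "\<dots> = (\<Prod>x\<in>V. card (C x))"
  proof -
    have "(\<Prod>x\<in>V. card (C x)) = (\<Prod>x\<in>Ev. card (C x)) * (\<Prod>x\<in>Od. card (C x))"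
      using finite_V by (subst prod.union_disjoint[symmetric]) (auto intro!: prod.cong)
    then show ?thesis by (simp add: C_def)
  qed
  also have "\<dots> = card (PiE V C)" by (simp add: card_PiE finite_V)
  also have "\<dots> \<le> card \<Omega>"
  proof (intro card_mono finite_\<Omega> subsetI)
    fix f assume f: "f \<in> PiE V C"
    have "f \<in> V \<rightarrow>\<^sub>E W" 
      by (rule subsetD[OF PiE_mono f]) (use AB in \<open>simp add: C_def\<close>)
    moreover have "(f x, f y) \<in> parcs H" if x: "x \<in> V" and y: "y \<in> nb x" for x y
    proof -
      have "y \<in> V" using y nb_V by (rule subsetD[rotated])
      then have "f x \<in> C x" "f y \<in> C y" using f x by (simp_all add: PiE_mem)
      then show ?thesis
        using lev_nb(3)[OF x y] AB(3) fully_adjacent_sym[OF AB(3)] by (auto simp: C_def fully_adjacent_def split: if_splits)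
    qed
    ultimately show "f \<in> \<Omega>" unfolding Hom_iff by blast
  qed
  finally show ?thesis .
qed

lemma Hom_PiE: "f \<in> \<Omega> \<Longrightarrow> f \<in> V \<rightarrow>\<^sub>E W"
  by (simp only: Hom_iff)

lemma Hom_W: "f \<in> \<Omega> \<Longrightarrow> x \<in> V \<Longrightarrow> f x \<in> W"
  using PiE_mem[OF Hom_PiE] .

lemma Hom_arc: "f \<in> \<Omega> \<Longrightarrow> x \<in> V \<Longrightarrow> y \<in> nb x \<Longrightarrow> (f x, f y) \<in> parcs H"
  using Hom_iff[THEN iffD1, THEN conjunct2, THEN bspec, THEN bspec] .

lemma image_nb_W: "f \<in> \<Omega> \<Longrightarrow> f ` nb x \<subseteq> W"
  by (intro image_subsetI Hom_W subsetD[OF nb_V])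

lemma image_nb_pos: "f \<in> \<Omega> \<Longrightarrow> x \<in> V \<Longrightarrow> 0 < card (f ` nb x)"
  using nb_ne finite_nb by (simp add: card_gt_0_iff)

lemma Hom_cn: "f \<in> \<Omega> \<Longrightarrow> x \<in> V \<Longrightarrow> f x \<in> cn (f ` nb x)"
  unfolding cn_def using Hom_arc Hom_W parcs_sym by auto

lemma finite_cn: "finite (cn S)" using finite_W cn_W finite_subset by blast

lemma cn_pos: "f \<in> \<Omega> \<Longrightarrow> x \<in> V \<Longrightarrow> 0 < card (cn (f ` nb x))"
  using Hom_cn finite_cn by (metis card_gt_0_iff empty_iff)

lemma eta_ge_cn: "S \<subseteq> W \<Longrightarrow> card S * card (cn S) \<le> eta H"
  by (intro eta_ge cn_W fully_adjacent_cn)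

lemma eta_pos: "\<Omega> \<noteq> {} \<Longrightarrow> 0 < eta H"
proof -
  assume "\<Omega> \<noteq> {}"
  then obtain f where f: "f \<in> \<Omega>" by blast
  have "0 < card (f ` nb (\<lambda>i\<in>{..<d}. 0)) * card (cn (f ` nb (\<lambda>i\<in>{..<d}. 0)))"
    using image_nb_pos[OF f origin_V] cn_pos[OF f origin_V] by simp
  also have "\<dots> \<le> eta H" by (intro eta_ge_cn image_nb_W f)
  finally show ?thesis .
qed

text \<open>The product of the two cardinalities is an integer, so a pair that is not maximal misses
  \<open>eta H\<close> by at least 1; \<open>ln y \<le> y - 1\<close> turns this into a loss of
  \<open>1 / eta H\<close>.\<close>

lemma ln_eta_ge:
  assumes f: "f \<in> \<Omega>" and x: "x \<in> V"
  shows "ln (card (f ` nb x)) + ln (card (cn (f ` nb x))) + of_bool (\<not> good (f ` nb x)) / eta H \<le> ln (eta H)"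
proof -
  define p where "p = card (f ` nb x) * card (cn (f ` nb x))"
  have p: "0 < p" "p \<le> eta H"
    using image_nb_pos[OF f x] cn_pos[OF f x] eta_ge_cn[OF image_nb_W[OF f]] by (auto simp: p_def)
  have ln: "ln (card (f ` nb x)) + ln (card (cn (f ` nb x))) = ln p"
    using image_nb_pos[OF f x] cn_pos[OF f x] by (simp add: p_def ln_mult)
  show ?thesis
  proof (cases "good (f ` nb x)")
    case True
    then show ?thesis using ln by (simp add: good_def p_def)
  next
    case False
    then have "p + 1 \<le> eta H" using p by (simp add: good_def p_def)
    then have "real p / eta H \<le> 1 - 1 / eta H" by (simp add: field_simps)
    moreover have "ln (real p / eta H) \<le> real p / eta H - 1" using p by (intro ln_le_minus_one) auto
    ultimately have "ln p - ln (eta H) \<le> - 1 / eta H" using p by (simp add: ln_div)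
    then show ?thesis using False ln by simp
  qed
qed

text \<open>An extension is determined by its odd values, and each of these lies in the common
  neighbourhood of the even values around it.\<close>

lemma card_extensions_le:
  assumes "g \<in> (\<lambda>f. restrict f Ev) ` \<Omega>"
  shows "card {f \<in> \<Omega>. restrict f Ev = g} \<le> (\<Prod>v\<in>Od. card (cn (g ` nb v)))"
proof -
  have "card {f \<in> \<Omega>. restrict f Ev = g} \<le> card (PiE Od (\<lambda>v. cn (g ` nb v)))"
  proof (rule card_inj_on_le[of "\<lambda>f. restrict f Od"])
    show "inj_on (\<lambda>f. restrict f Od) {f \<in> \<Omega>. restrict f Ev = g}"
    proof (rule inj_onI)
      fix f h assume f: "f \<in> {f \<in> \<Omega>. restrict f Ev = g}" and h: "h \<in> {f \<in> \<Omega>. restrict f Ev = g}"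
        and eq: "restrict f Od = restrict h Od"
      have eq2: "restrict f Ev = restrict h Ev" using f h by simp
      have "f x = h x" if "x \<in> V" for x
        using fun_cong[OF eq, of x] fun_cong[OF eq2, of x] that by (cases "even (lev x)") auto
      moreover have "f \<in> V \<rightarrow>\<^sub>E W" "h \<in> V \<rightarrow>\<^sub>E W" using f h by (simp_all add: Hom_PiE)
      ultimately show "f = h" by (metis PiE_ext)
    qed
    show "(\<lambda>f. restrict f Od) ` {f \<in> \<Omega>. restrict f Ev = g} \<subseteq> PiE Od (\<lambda>v. cn (g ` nb v))"
    proof (rule image_subsetI)
      fix f assume f: "f \<in> {f \<in> \<Omega>. restrict f Ev = g}"
      have "f v \<in> cn (g ` nb v)" if v: "v \<in> Od" for v
      proof -
        have "g ` nb v = f ` nb v" using nb_Od[OF v] f by (intro image_cong) auto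
        then show ?thesis using Hom_cn[of f v] f v by simp
      qed
      then show "restrict f Od \<in> PiE Od (\<lambda>v. cn (g ` nb v))" by (intro restrict_PiE_iff[THEN iffD2]) auto
    qed
    show "finite (PiE Od (\<lambda>v. cn (g ` nb v)))" using finite_V finite_cn by (intro finite_PiE) auto
  qed
  then show ?thesis using finite_V by (simp add: card_PiE)
qed

text \<open>
  The even class is sampled from the mixtures, then the odd class uniformly given the even one.  The
  resulting subprobability is compared with the uniform distribution via \<open>ln y \<le> y - 1\<close>.
\<close>

lemma sum_log_excess_le:
  fixes \<pi> :: "(nat \<Rightarrow> nat) \<Rightarrow> 'k \<Rightarrow> ((nat \<Rightarrow> nat) \<Rightarrow> 'a) \<Rightarrow> real"
    and \<kappa> :: "(nat \<Rightarrow> nat) \<Rightarrow> 'k \<Rightarrow> (nat \<Rightarrow> nat) \<Rightarrow> ((nat \<Rightarrow> nat) \<Rightarrow> 'a) \<Rightarrow> 'a \<Rightarrow> real"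
  assumes K: "finite K"
    and \<pi>0: "\<And>v k f. 0 \<le> \<pi> v k f" and \<pi>1: "\<And>v f. v \<in> Od \<Longrightarrow> (\<Sum>k\<in>K. \<pi> v k f) \<le> 1"
    and \<kappa>0: "\<And>v k u f a. 0 \<le> \<kappa> v k u f a" and \<kappa>1: "\<And>v k u f. v \<in> Od \<Longrightarrow> k \<in> K \<Longrightarrow> (\<Sum>a\<in>W. \<kappa> v k u f a) \<le> 1"
    and \<pi>_dep: "\<And>v k f g. v \<in> Od \<Longrightarrow> k \<in> K \<Longrightarrow>
       (\<And>x. x \<in> Ev \<Longrightarrow> (\<And>u. u \<in> nb v \<Longrightarrow> lev x < lev u) \<Longrightarrow> f x = g x) \<Longrightarrow> \<pi> v k f = \<pi> v k g"
    and \<kappa>_dep: "\<And>v k u f g. v \<in> Od \<Longrightarrow> k \<in> K \<Longrightarrow> u \<in> nb v \<Longrightarrow>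
       (\<And>x. x \<in> Ev \<Longrightarrow> lev x < lev u \<Longrightarrow> f x = g x) \<Longrightarrow> \<kappa> v k u f = \<kappa> v k u g"
    and kK: "\<And>v f. v \<in> Od \<Longrightarrow> f \<in> \<Omega> \<Longrightarrow> k v f \<in> K"
    and \<pi>_pos: "\<And>v f. v \<in> Od \<Longrightarrow> f \<in> \<Omega> \<Longrightarrow> 0 < \<pi> v (k v f) f"
    and \<kappa>_pos: "\<And>v f u. v \<in> Od \<Longrightarrow> f \<in> \<Omega> \<Longrightarrow> u \<in> nb v \<Longrightarrow> 0 < \<kappa> v (k v f) u f (f u)"
  shows "(\<Sum>f\<in>\<Omega>. \<Sum>v\<in>Od. ln (eta H) - ln (card (cn (f ` nb v)))
    + (ln (\<pi> v (k v f) f) + (\<Sum>u\<in>nb v. ln (\<kappa> v (k v f) u f (f u)))) / \<Delta>) \<le> 0"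
proof (cases "\<Omega> = {}")
  case False
  define M where "M v f = (\<Sum>k\<in>K. \<pi> v k f * (\<Prod>u\<in>nb v. \<kappa> v k u f (f u)))" for v f
  define Q where "Q f = (\<Prod>v\<in>Od. M v f powr (1 / \<Delta>) / card (cn (f ` nb v)))" for f
  define r where "r f = restrict f Ev" for f :: "(nat \<Rightarrow> nat) \<Rightarrow> 'a"
  have \<Delta>0: "0 < \<Delta>" using \<Delta>_ge d_ge by linarith
  have M0: "0 \<le> M v f" for v f
    by (auto simp: M_def \<pi>0 \<kappa>0 intro!: sum_nonneg mult_nonneg_nonneg prod_nonneg)
  have fin: "finite Od" "finite Ev" using finite_V by auto
  have "(\<Sum>f\<in>Ev \<rightarrow>\<^sub>E W. \<Prod>v\<in>Od. M v f powr (1 / \<Delta>)) \<le> 1"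
    unfolding M_def
  proof (rule conditional_Shearer_mixture[where lev = lev])
    fix u assume u: "u \<in> Ev"
    have "{v \<in> Od. u \<in> nb v} = nb u" using nb_Ev[OF u] nb_sym by auto
    then show "card {v \<in> Od. u \<in> nb v} = \<Delta>" using card_nb_\<Delta> u by simp
  next
    show "nb v \<subseteq> Ev" if "v \<in> Od" for v using nb_Od[OF that] .
    show "nb v \<noteq> {}" if "v \<in> Od" for v using nb_ne that by simp
  next
    show "\<pi> v k f = \<pi> v k g" if "v \<in> Od" "k \<in> K"
       "\<And>x. x \<in> Ev \<Longrightarrow> (\<And>u. u \<in> nb v \<Longrightarrow> lev x < lev u) \<Longrightarrow> f x = g x" for v k f g
      using that by (rule \<pi>_dep)
    show "\<kappa> v k u f = \<kappa> v k u g" if "v \<in> Od" "k \<in> K" "u \<in> nb v"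
       "\<And>x. x \<in> Ev \<Longrightarrow> lev x < lev u \<Longrightarrow> f x = g x" for v k u f g
      using that by (rule \<kappa>_dep)
  qed (use fin finite_W \<Delta>0 \<pi>0 \<pi>1 \<kappa>0 \<kappa>1 in auto)
  then have mix: "(\<Sum>g\<in>r ` \<Omega>. \<Prod>v\<in>Od. M v g powr (1 / \<Delta>)) \<le> 1"
  proof (rule order_trans[rotated], intro sum_mono2)
    show "finite (Ev \<rightarrow>\<^sub>E W)" using fin finite_W by (intro finite_PiE) auto
    show "r ` \<Omega> \<subseteq> Ev \<rightarrow>\<^sub>E W" using Hom_W by (intro image_subsetI) (simp add: r_def)
  qed (simp add: prod_nonneg)
  \<comment> \<open>\<open>Q\<close> reads only even vertices, so the sum over
    \<open>\<Omega>\<close> can be grouped by the even part; the number of odd extensions then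
    cancels against the denominators in \<open>Q\<close>.\<close>
  have rQ: "Q f = Q (r f)" if "f \<in> \<Omega>" for f
  proof -
    have "M v f = M v (r f)" if v: "v \<in> Od" for v
    proof -
      have "\<pi> v k f = \<pi> v k (r f)" if "k \<in> K" for k
        using v that by (intro \<pi>_dep) (auto simp: r_def)
      moreover have "\<kappa> v k u f = \<kappa> v k u (r f)" if "k \<in> K" "u \<in> nb v" for k u
        using v that by (intro \<kappa>_dep) (auto simp: r_def)
      moreover have "r f u = f u" if "u \<in> nb v" for u using nb_Od[OF v] that by (auto simp: r_def)
      ultimately show ?thesis by (simp add: M_def)
    qed
    moreover have "r f ` nb v = f ` nb v" if v: "v \<in> Od" for v
      using nb_Od[OF v] by (intro image_cong) (auto simp: r_def)
    ultimately show ?thesis by (simp add: Q_def)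
  qed
  have "(\<Sum>f\<in>\<Omega>. Q f) = (\<Sum>f\<in>\<Omega>. Q (r f))" by (intro sum.cong rQ refl)
  also have "\<dots> = (\<Sum>g\<in>r ` \<Omega>. \<Sum>f\<in>{f \<in> \<Omega>. r f = g}. Q (r f))"
    by (rule sum.image_gen[OF finite_\<Omega>])
  also have "\<dots> = (\<Sum>g\<in>r ` \<Omega>. card {f \<in> \<Omega>. r f = g} * Q g)" by simp
  also have "\<dots> \<le> (\<Sum>g\<in>r ` \<Omega>. \<Prod>v\<in>Od. M v g powr (1 / \<Delta>))"
  proof (rule sum_mono)
    fix g assume g: "g \<in> r ` \<Omega>"
    have Q0: "0 \<le> Q g" by (simp add: Q_def prod_nonneg)
    have "real (card {f \<in> \<Omega>. r f = g}) \<le> real (\<Prod>v\<in>Od. card (cn (g ` nb v)))"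
      unfolding of_nat_le_iff using card_extensions_le[of g] g by (simp add: r_def)
    then have "card {f \<in> \<Omega>. r f = g} * Q g \<le> real (\<Prod>v\<in>Od. card (cn (g ` nb v))) * Q g"
      by (rule mult_right_mono[OF _ Q0])
    also have "\<dots> = (\<Prod>v\<in>Od. card (cn (g ` nb v)) * (M v g powr (1 / \<Delta>) / card (cn (g ` nb v))))"
      unfolding Q_def of_nat_prod by (rule prod.distrib[symmetric])
    also have "\<dots> \<le> (\<Prod>v\<in>Od. M v g powr (1 / \<Delta>))"
      by (intro prod_mono) auto
    finally show "card {f \<in> \<Omega>. r f = g} * Q g \<le> (\<Prod>v\<in>Od. M v g powr (1 / \<Delta>))" .
  qed
  also note mix
  finally have Q1: "(\<Sum>f\<in>\<Omega>. Q f) \<le> 1" .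
  have \<Omega>0: "0 < card \<Omega>" using False finite_\<Omega> by (simp add: card_gt_0_iff)
  have bound: "0 < Q f \<and> (\<Sum>v\<in>Od. (ln (\<pi> v (k v f) f) + (\<Sum>u\<in>nb v. ln (\<kappa> v (k v f) u f (f u)))) / \<Delta>
      - ln (card (cn (f ` nb v)))) \<le> ln (Q f)" if f: "f \<in> \<Omega>" for f
  proof -
    \<comment> \<open>The mixture dominates its single term at the index \<open>k v f\<close>, so
      only the true candidate is charged.\<close>
    have each: "0 < M v f \<and> ln (\<pi> v (k v f) f) + (\<Sum>u\<in>nb v. ln (\<kappa> v (k v f) u f (f u))) \<le> ln (M v f)" if v: "v \<in> Od" for v
    proof -
      define t where "t = \<pi> v (k v f) f * (\<Prod>u\<in>nb v. \<kappa> v (k v f) u f (f u))"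
      have pp: "0 < (\<Prod>u\<in>nb v. \<kappa> v (k v f) u f (f u))" using \<kappa>_pos[OF v f] by (intro prod_pos) auto
      then have t: "0 < t" using \<pi>_pos[OF v f] by (simp add: t_def)
      have "t \<le> M v f" unfolding t_def M_def
        by (rule member_le_sum[OF kK[OF v f]]) (auto simp: K \<pi>0 \<kappa>0 prod_nonneg)
      moreover have "ln t = ln (\<pi> v (k v f) f) + (\<Sum>u\<in>nb v. ln (\<kappa> v (k v f) u f (f u)))"
        unfolding t_def ln_mult_pos[OF \<pi>_pos[OF v f] pp]
        using \<kappa>_pos[OF v f] finite_nb by (subst ln_prod) (auto simp: less_imp_neq[symmetric])
      ultimately show ?thesis using t by (metis less_le_trans ln_le_cancel_iff)
    qed
    have pos: "0 < M v f powr (1 / \<Delta>) / card (cn (f ` nb v))" if "v \<in> Od" for v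
      using each[OF that] cn_pos[OF f] that by simp
    then have "0 < Q f" unfolding Q_def by (intro prod_pos) auto
    moreover have "ln (Q f) = (\<Sum>v\<in>Od. ln (M v f powr (1 / \<Delta>) / card (cn (f ` nb v))))"
      unfolding Q_def by (rule ln_prod[OF fin(1)]) (rule less_imp_neq[OF pos, symmetric])
    moreover have "(\<Sum>v\<in>Od. (ln (\<pi> v (k v f) f) + (\<Sum>u\<in>nb v. ln (\<kappa> v (k v f) u f (f u)))) / \<Delta>
      - ln (card (cn (f ` nb v)))) \<le> (\<Sum>v\<in>Od. ln (M v f powr (1 / \<Delta>) / card (cn (f ` nb v))))"
    proof (rule sum_mono)
      fix v assume v: "v \<in> Od"
      have "ln (M v f powr (1 / \<Delta>) / card (cn (f ` nb v))) = ln (M v f) / \<Delta> - ln (card (cn (f ` nb v)))"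
        using each[OF v] cn_pos[OF f, of v] v by (simp add: ln_div ln_powr)
      then show "(ln (\<pi> v (k v f) f) + (\<Sum>u\<in>nb v. ln (\<kappa> v (k v f) u f (f u)))) / \<Delta>
        - ln (card (cn (f ` nb v))) \<le> ln (M v f powr (1 / \<Delta>) / card (cn (f ` nb v)))"
        using each[OF v] \<Delta>0 by (simp add: divide_right_mono)
    qed
    ultimately show ?thesis by simp
  qed
  have ln\<Omega>: "card Od * ln (eta H) \<le> ln (card \<Omega>)"
  proof -
    have "real (eta H) ^ card Od \<le> card \<Omega>" using card_Hom_ge by (metis of_nat_le_iff of_nat_power)
    then have "ln (real (eta H) ^ card Od) \<le> ln (card \<Omega>)" using eta_pos[OF False] by (subst ln_le_cancel_iff) (auto simp: \<Omega>0)
    then show ?thesis using eta_pos[OF False] by (simp add: ln_realpow)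
  qed
  \<comment> \<open>As \<open>card Od * ln (eta H) \<le> ln (card \<Omega>)\<close>, each summand is
    at most \<open>ln (card \<Omega> * Q f)\<close>, hence at most
    \<open>card \<Omega> * Q f - 1\<close>, and these sum to at most 0.\<close>
  have "(\<Sum>f\<in>\<Omega>. \<Sum>v\<in>Od. ln (eta H) - ln (card (cn (f ` nb v)))
    + (ln (\<pi> v (k v f) f) + (\<Sum>u\<in>nb v. ln (\<kappa> v (k v f) u f (f u)))) / \<Delta>) \<le> (\<Sum>f\<in>\<Omega>. card \<Omega> * Q f - 1)"
  proof (rule sum_mono)
    fix f assume f: "f \<in> \<Omega>"
    have "(\<Sum>v\<in>Od. ln (eta H) - ln (card (cn (f ` nb v)))
      + (ln (\<pi> v (k v f) f) + (\<Sum>u\<in>nb v. ln (\<kappa> v (k v f) u f (f u)))) / \<Delta>)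
      = card Od * ln (eta H) + (\<Sum>v\<in>Od. (ln (\<pi> v (k v f) f) + (\<Sum>u\<in>nb v. ln (\<kappa> v (k v f) u f (f u)))) / \<Delta>
      - ln (card (cn (f ` nb v))))"
      by (simp add: sum.distrib sum_subtractf)
    also have "\<dots> \<le> ln (card \<Omega>) + ln (Q f)" using bound[OF f] ln\<Omega> by linarith
    also have "\<dots> = ln (card \<Omega> * Q f)" using bound[OF f] \<Omega>0 by (simp add: ln_mult)
    also have "\<dots> \<le> card \<Omega> * Q f - 1" using bound[OF f] \<Omega>0 by (intro ln_le_minus_one) simp
    finally show "(\<Sum>v\<in>Od. ln (eta H) - ln (card (cn (f ` nb v)))
      + (ln (\<pi> v (k v f) f) + (\<Sum>u\<in>nb v. ln (\<kappa> v (k v f) u f (f u)))) / \<Delta>) \<le> card \<Omega> * Q f - 1" .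
  qed
  also have "\<dots> = card \<Omega> * ((\<Sum>f\<in>\<Omega>. Q f) - 1)"
    by (simp add: sum_subtractf sum_distrib_left right_diff_distrib)
  also have "\<dots> \<le> 0" using Q1 by (intro mult_nonneg_nonpos) auto
  finally show ?thesis .
qed simp

end

section \<open>Uniform kernels damped outside a predicted set\<close>

definition kern :: "real \<Rightarrow> 'a set \<Rightarrow> 'a set \<Rightarrow> 'a \<Rightarrow> real" where
  "kern l T P a = (if a \<in> T then if a \<in> P then 1 else 1 - l else 0) / (\<Sum>b\<in>T. if b \<in> P then 1 else 1 - l)"

lemma kern_nonneg: "l \<le> 1 \<Longrightarrow> 0 \<le> kern l T P a"
  unfolding kern_def by (intro divide_nonneg_nonneg sum_nonneg) auto

text \<open>The total is 1 unless the normaliser vanishes, as for empty \<open>T\<close>; division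
  by zero then makes the kernel 0.\<close>

lemma kern_sum:
  assumes "T \<subseteq> W" "finite W" shows "(\<Sum>a\<in>W. kern l T P a) \<le> 1"
proof -
  have "(\<Sum>a\<in>W. kern l T P a) = (\<Sum>a\<in>W. if a \<in> T then if a \<in> P then 1 else 1 - l else 0) / (\<Sum>b\<in>T. if b \<in> P then 1 else 1 - l)"
    by (simp add: kern_def sum_divide_distrib)
  also have "(\<Sum>a\<in>W. if a \<in> T then if a \<in> P then 1 else 1 - l else 0) = (\<Sum>b\<in>T. if b \<in> P then 1 else 1 - l)"
    using assms by (subst sum.inter_restrict[symmetric]) (auto simp: Int_absorb1)
  finally show ?thesis by simp
qed

text \<open>Damping lowers the normaliser from \<open>card T\<close> by \<open>l\<close> for each
  point of \<open>T\<close> outside \<open>P\<close>, a gain at every \<open>a\<close>. A damped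
  \<open>a\<close> itself pays \<open>ln (1 - l)\<close>, which is at least \<open>- 2 * l\<close>
  for \<open>l \<le> 1 / 2\<close>.\<close>

lemma kern_bound:
  assumes T: "finite T" "a \<in> T" and l: "0 \<le> l" "l \<le> 1 / 2"
  shows "0 < kern l T P a"
    and "- ln (card T) + l / card T * of_bool (\<not> T \<subseteq> P) - 2 * l * of_bool (a \<notin> P) \<le> ln (kern l T P a)"
proof -
  define Z where "Z = (\<Sum>b\<in>T. if b \<in> P then 1 else 1 - l)"
  define w where "w = (if a \<in> P then 1 else 1 - l)"
  have k: "kern l T P a = w / Z" using T by (simp add: kern_def Z_def w_def)
  have w: "0 < w" using l by (auto simp: w_def)
  have cT: "1 \<le> card T" using T by (metis One_nat_def Suc_leI card_gt_0_iff empty_iff)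
  have Z: "0 < Z" unfolding Z_def using T l by (intro sum_pos) auto
  have Zc: "Z = card T - l * card (T - P)"
  proof -
    have "Z = (\<Sum>b\<in>T. 1 - l * of_bool (b \<in> T - P))" unfolding Z_def by (intro sum.cong) auto
    also have "\<dots> = card T - l * card (T - P)"
    proof -
      have "(\<Sum>b\<in>T. of_bool (b \<in> T - P)) = (\<Sum>b\<in>T - P. 1 :: real)"
        using T by (intro sum.mono_neutral_cong_right) auto
      then show ?thesis by (simp add: sum_subtractf sum_distrib_left[symmetric])
    qed
    finally show ?thesis .
  qed
  show "0 < kern l T P a" using k w Z by simp
  have "Z \<le> card T - l * of_bool (\<not> T \<subseteq> P)"
  proof (cases "T \<subseteq> P")
    case False
    then have "1 \<le> card (T - P)" using T by (metis Diff_eq_empty_iff One_nat_def Suc_leI card_gt_0_iff finite_Diff)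
    then have "l * 1 \<le> l * card (T - P)" using l by (intro mult_left_mono) auto
    then show ?thesis using Zc False by simp
  qed (use Zc l in simp)
  then have "Z / card T \<le> 1 - l / card T * of_bool (\<not> T \<subseteq> P)" using cT by (simp add: field_simps)
  moreover have "ln (Z / card T) \<le> Z / card T - 1" using Z cT by (intro ln_le_minus_one) simp
  ultimately have "ln Z \<le> ln (card T) - l / card T * of_bool (\<not> T \<subseteq> P)" using Z cT by (simp add: ln_div)
  moreover have "- 2 * l * of_bool (a \<notin> P) \<le> ln w"
  proof (cases "a \<in> P")
    case False
    have "- l - 2 * l\<^sup>2 \<le> ln (1 - l)" using l by (intro ln_one_minus_pos_lower_bound) auto
    moreover have "2 * l\<^sup>2 \<le> l" using l mult_left_mono[of "2 * l" 1 l] by (simp add: power2_eq_square)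
    ultimately show ?thesis using False by (simp add: w_def)
  qed (simp add: w_def)
  moreover have "ln (kern l T P a) = ln w - ln Z" using k w Z by (simp add: ln_div)
  ultimately show "- ln (card T) + l / card T * of_bool (\<not> T \<subseteq> P) - 2 * l * of_bool (a \<notin> P) \<le> ln (kern l T P a)" by simp
qed

section \<open>The sampling scheme\<close>

text \<open>A proper subset has at least one element less, a relative loss of
  \<open>1 / card S\<close> or more.\<close>

lemma ln_card_subset:
  assumes "finite S" "P \<subseteq> S" "P \<noteq> {}" "card S \<le> q"
  shows "ln (card P) + of_bool (P \<noteq> S) / q \<le> ln (card S)"
proof (cases "P = S")
  case False
  then have lt: "card P < card S" using assms by (intro psubset_card_mono) auto
  have P: "0 < card P" using assms finite_subset by (metis card_gt_0_iff)
  have "ln (card P / card S) \<le> card P / card S - 1" using P lt by (intro ln_le_minus_one) simp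
  moreover have "real (card P) / card S \<le> 1 - 1 / card S" using lt by (simp add: field_simps)
  moreover have "1 / real q \<le> 1 / card S" using assms lt by (intro divide_left_mono) auto
  ultimately show ?thesis using False P lt by (simp add: ln_div)
qed simp

text \<open>
  At a typical odd vertex \<open>v\<close> (many nonzero coordinates) the sets \<open>I v\<close>, \<open>J v\<close>, the coordinate \<open>jj v\<close> and the
  list \<open>L v\<close> consist of nonzero coordinates, so that lowering them decreases the level.  The candidate
  announced for \<open>v\<close> is a pair: \<open>f ` nb v\<close> together with its part seen in the directions \<open>I v\<close>.  The former is
  predicted by the vertex obtained by lowering \<open>L v\<close>.  At the neighbours \<open>u = dn i v\<close>, \<open>i \<in> J v\<close>, values
  outside the image of \<open>f\<close> in the directions \<open>I v\<close> from \<open>dn (jj v) u\<close> are damped.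
\<close>

locale torus_scheme = torus_homs +
  fixes typical :: "(nat \<Rightarrow> nat) \<Rightarrow> bool" and I J :: "(nat \<Rightarrow> nat) \<Rightarrow> nat set"
    and jj :: "(nat \<Rightarrow> nat) \<Rightarrow> nat" and L :: "(nat \<Rightarrow> nat) \<Rightarrow> nat list"
    and k0 :: nat and \<delta> :: real
  assumes \<delta>: "0 < \<delta>" "\<delta> \<le> 1 / 2"
    and sub: "typical v \<Longrightarrow> I v \<union> J v \<union> {jj v} \<union> set (L v) \<subseteq> {i. i < d \<and> 0 < v i}"
    and card_I: "typical v \<Longrightarrow> card (I v) = k0" and card_J: "typical v \<Longrightarrow> card (J v) = k0"
    and IJ: "typical v \<Longrightarrow> I v \<inter> J v = {}" and jj: "typical v \<Longrightarrow> jj v \<notin> I v \<union> J v"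
    and L: "typical v \<Longrightarrow> distinct (L v)" "typical v \<Longrightarrow> length (L v) = 2 * m"
begin

text \<open>With this value a wrong prediction at a vertex of \<open>D' v\<close> costs
  \<open>2 * l\<close>, half of the gain \<open>1 / card W\<close> at a vertex of \<open>D v\<close>
  when the directions \<open>I v\<close> miss part of the image of \<open>nb v\<close>.\<close>

definition l :: real where "l = 1 / (4 * card W)"

definition D where "D v = (\<lambda>i. dn i v) ` I v"
definition D' where "D' v = (\<lambda>i. dn i v) ` J v"
definition pred where "pred v u f = f ` (\<lambda>i. dn i (dn (jj v) u)) ` I v" for f :: "(nat \<Rightarrow> nat) \<Rightarrow> 'a"

text \<open>On \<open>D v\<close> the second component of the candidate is used: when it is a proper
  subset of the first, the saving over \<open>k0\<close> vertices pays for the wrong predictions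
  made from incomplete images.\<close>

definition \<kappa> :: "(nat \<Rightarrow> nat) \<Rightarrow> 'a set \<times> 'a set \<Rightarrow> (nat \<Rightarrow> nat) \<Rightarrow> ((nat \<Rightarrow> nat) \<Rightarrow> 'a) \<Rightarrow> 'a \<Rightarrow> real" where
  "\<kappa> v k u f =
    (if typical v \<and> u \<in> D v then kern l (snd k) UNIV
     else if typical v \<and> u \<in> D' v then kern l (fst k) (pred v u f)
     else kern l (fst k) UNIV)"

text \<open>At a typical vertex most of the mass sits on the predicted candidate, whose cost is then
  at most \<open>2 * \<delta>\<close>; the rest is spread over all \<open>4 ^ card W\<close> pairs,
  so no candidate has weight 0.\<close>

definition \<pi> :: "(nat \<Rightarrow> nat) \<Rightarrow> 'a set \<times> 'a set \<Rightarrow> ((nat \<Rightarrow> nat) \<Rightarrow> 'a) \<Rightarrow> real" where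
  "\<pi> v k f =
    (if typical v then if fst k = snd k \<and> fst k = f ` nb (fold dn (L v) v) then 1 - \<delta> else \<delta> / 4 ^ card W
     else 1 / 4 ^ card W)"

definition kk :: "(nat \<Rightarrow> nat) \<Rightarrow> ((nat \<Rightarrow> nat) \<Rightarrow> 'a) \<Rightarrow> 'a set \<times> 'a set" where
  "kk v f = (f ` nb v, if typical v then f ` D v else f ` nb v)"

text \<open>The cost \<open>- ln (\<delta> / 4 ^ card W)\<close> of an unpredicted candidate at a
  typical vertex.\<close>

definition \<Lambda> :: real where "\<Lambda> = card W * ln 4 - ln \<delta>"

lemma l_bounds: "0 \<le> l" "l \<le> 1 / 2"
proof -
  show "0 \<le> l" by (simp add: l_def)
  show "l \<le> 1 / 2" by (cases "card W") (auto simp: l_def field_simps)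
qed

lemma idx: "typical v \<Longrightarrow> I v \<subseteq> {..<d}" "typical v \<Longrightarrow> J v \<subseteq> {..<d}" "typical v \<Longrightarrow> jj v < d" "typical v \<Longrightarrow> set (L v) \<subseteq> {..<d}"
  using sub[of v] by auto

lemma D_nb: "v \<in> V \<Longrightarrow> typical v \<Longrightarrow> D v \<subseteq> nb v" and D'_nb: "v \<in> V \<Longrightarrow> typical v \<Longrightarrow> D' v \<subseteq> nb v"
  unfolding D_def D'_def using idx(1,2)[of v] by (auto intro: dn_nb)

lemma D_D': "v \<in> V \<Longrightarrow> typical v \<Longrightarrow> D v \<inter> D' v = {}"
  unfolding D_def D'_def using inj_on_image_Int[OF inj_dn[of v] idx(1) idx(2), of v v] IJ[of v] by simp

lemma card_D: "v \<in> V \<Longrightarrow> typical v \<Longrightarrow> card (D v) = k0"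
  unfolding D_def using card_image[OF inj_on_subset[OF inj_dn idx(1)]] card_I by simp

lemma \<Lambda>_nonneg: "0 \<le> \<Lambda>"
proof -
  have "0 \<le> card W * ln (4 :: real)" by simp
  moreover have "ln \<delta> \<le> 0" using \<delta> by simp
  ultimately show ?thesis unfolding \<Lambda>_def by linarith
qed

lemma \<pi>_sum: "(\<Sum>k\<in>Pow W \<times> Pow W. \<pi> v k f) \<le> 1"
proof -
  have card4: "card (Pow W \<times> Pow W) = 4 ^ card W"
    by (simp add: card_cartesian_product card_Pow finite_W flip: power_mult_distrib)
  have fin: "finite (Pow W \<times> Pow W)" using finite_W by simp
  show ?thesis
  proof (cases "typical v")
    case True
    define s where "s = f ` nb (fold dn (L v) v)"
    have "(\<Sum>k\<in>Pow W \<times> Pow W. \<pi> v k f) \<le> (\<Sum>k\<in>Pow W \<times> Pow W. (if k = (s, s) then 1 - \<delta> else 0) + \<delta> / 4 ^ card W)"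
      using True \<delta> by (intro sum_mono) (auto simp: \<pi>_def s_def prod_eq_iff)
    also have "\<dots> = (if (s, s) \<in> Pow W \<times> Pow W then 1 - \<delta> else 0) + \<delta>"
      using fin by (simp add: sum.distrib card4 sum.delta)
    also have "\<dots> \<le> 1" using \<delta> by auto
    finally show ?thesis .
  next
    case False
    then show ?thesis using card4 by (simp add: \<pi>_def)
  qed
qed

lemma dn_below:
  assumes u: "u \<in> Ev" and j: "j < d" "0 < u j" and i: "i < d" "0 < u i" "i \<noteq> j"
  shows "dn i (dn j u) \<in> Ev" "lev (dn i (dn j u)) < lev u"
proof -
  have uV: "u \<in> V" and eu: "even (lev u)" using u by simp_all
  have V1: "dn j u \<in> V" using dn_V[OF uV j(1)] .
  have V2: "dn i (dn j u) \<in> V" using dn_V[OF V1 i(1)] .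
  have "0 < dn j u i" using i by (simp add: dn_def)
  then have *: "lev u = lev (dn i (dn j u)) + 2" using lev_dn[OF uV j] lev_dn[OF V1 i(1)] by simp
  show "lev (dn i (dn j u)) < lev u" using * by simp
  show "dn i (dn j u) \<in> Ev" using V2 eu * by simp
qed

lemma \<kappa>_dep:
  assumes v: "v \<in> Od" and u: "u \<in> nb v"
    and eq: "\<And>x. x \<in> Ev \<Longrightarrow> lev x < lev u \<Longrightarrow> f x = g x"
  shows "\<kappa> v k u f = \<kappa> v k u g"
proof (cases "typical v \<and> u \<in> D' v")
  case True
  then obtain i where i: "i \<in> J v" "u = dn i v" by (auto simp: D'_def)
  have uE: "u \<in> Ev" using nb_Od[OF v] u by (rule subsetD)
  have t: "typical v" using True by simp
  have "f x = g x" if x: "x \<in> (\<lambda>i. dn i (dn (jj v) u)) ` I v" for x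
  proof -
    obtain i' where i': "x = dn i' (dn (jj v) u)" "i' \<in> I v" using x by (rule imageE)
    \<comment> \<open>Distinctness leaves the entries of \<open>u = dn i v\<close> at
      \<open>jj v\<close> and \<open>i'\<close> positive, so both lowerings decrease the
      level.\<close>
    have "i' \<noteq> i" "jj v \<noteq> i" "i' \<noteq> jj v" using IJ[OF t] jj[OF t] i i' by auto
    moreover have "i' < d" "0 < v i'" "jj v < d" "0 < v (jj v)" using sub[OF t] i' by auto
    ultimately show ?thesis
      using eq dn_below[OF uE, of "jj v" i'] i i' by (simp add: dn_def)
  qed
  then have "pred v u f = pred v u g" unfolding pred_def by (rule image_cong[OF refl])
  then show ?thesis by (simp add: \<kappa>_def)
qed (auto simp: \<kappa>_def)

lemma w_Od:
  assumes "v \<in> Od" "typical v"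
  shows "fold dn (L v) v \<in> Od" "lev v = lev (fold dn (L v) v) + 2 * m"
proof -
  have vV: "v \<in> V" and ov: "odd (lev v)" using assms by simp_all
  have V: "fold dn (L v) v \<in> V" by (rule fold_dn_V[OF vV idx(4)[OF assms(2)]])
  show lev: "lev v = lev (fold dn (L v) v) + 2 * m"
    using lev_fold_dn[OF vV L(1)[OF assms(2)] idx(4)[OF assms(2)]] sub[OF assms(2)] L(2)[OF assms(2)] by auto
  have "odd (lev (fold dn (L v) v))" using lev ov by simp
  then show "fold dn (L v) v \<in> Od" using V by simp
qed

text \<open>Lowering \<open>2 * m\<close> coordinates leaves room for a wraparound at both ends:
  every neighbour of the lower vertex has smaller level than every neighbour of
  \<open>v\<close>.\<close>

lemma \<pi>_dep:
  assumes v: "v \<in> Od"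
    and eq: "\<And>x. x \<in> Ev \<Longrightarrow> (\<And>u. u \<in> nb v \<Longrightarrow> lev x < lev u) \<Longrightarrow> f x = g x"
  shows "\<pi> v k f = \<pi> v k g"
proof (cases "typical v")
  case True
  define w where "w = fold dn (L v) v"
  have w: "w \<in> Od" "lev v = lev w + 2 * m" using w_Od[OF v True] by (simp_all add: w_def)
  have wV: "w \<in> V" and vV: "v \<in> V" using w v by simp_all
  have "f x = g x" if x: "x \<in> nb w" for x
  proof (rule eq)
    show "x \<in> Ev" using nb_Od[OF w(1)] x by (rule subsetD)
    show "lev x < lev u" if "u \<in> nb v" for u
      using lev_nb(1)[OF wV x] lev_nb(2)[OF vV that] w(2) by linarith
  qed
  then have "f ` nb w = g ` nb w" by (rule image_cong[OF refl])
  then show ?thesis by (simp add: \<pi>_def w_def)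
qed (simp add: \<pi>_def)

lemma kk_mem:
  assumes "f \<in> \<Omega>" "v \<in> V"
  shows "kk v f \<in> Pow W \<times> Pow W"
proof -
  have "f ` D v \<subseteq> W" if "typical v" using image_mono[OF D_nb[OF assms(2) that]] image_nb_W[OF assms(1)] by (rule order_trans)
  then show ?thesis using image_nb_W[OF assms(1)] by (simp add: kk_def)
qed

lemma \<kappa>_kk_pos:
  assumes "f \<in> \<Omega>" "v \<in> V" "u \<in> nb v"
  shows "0 < \<kappa> v (kk v f) u f (f u)"
  using assms finite_nb finite_subset[OF D_nb[OF assms(2)] finite_nb]
  unfolding \<kappa>_def kk_def by (auto intro!: kern_bound(1) l_bounds)

text \<open>The share of \<open>v\<close> in the excess bounded by \<open>sum_log_excess_le\<close>.
  Lower bounds on it, averaged over \<open>\<Omega>\<close>, limit how often defects occur.\<close>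

definition T :: "(nat \<Rightarrow> nat) \<Rightarrow> ((nat \<Rightarrow> nat) \<Rightarrow> 'a) \<Rightarrow> real" where
  "T v f = ln (eta H) - ln (card (cn (f ` nb v)))
    + (ln (\<pi> v (kk v f) f) + (\<Sum>u\<in>nb v. ln (\<kappa> v (kk v f) u f (f u)))) / \<Delta>"

lemma sum_T: "(\<Sum>f\<in>\<Omega>. \<Sum>v\<in>Od. T v f) \<le> 0"
  unfolding T_def
proof (rule sum_log_excess_le)
  show "finite (Pow W \<times> Pow W)" using finite_W by simp
  show "0 \<le> \<pi> v k f" for v k f using \<delta> by (simp add: \<pi>_def)
  show "(\<Sum>k\<in>Pow W \<times> Pow W. \<pi> v k f) \<le> 1" for v f by (rule \<pi>_sum)
  show "0 \<le> \<kappa> v k u f a" for v k u f a using l_bounds by (simp add: \<kappa>_def kern_nonneg)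
  show "(\<Sum>a\<in>W. \<kappa> v k u f a) \<le> 1" if "k \<in> Pow W \<times> Pow W" for v k u f
    using that finite_W by (auto simp: \<kappa>_def intro!: kern_sum)
  show "\<pi> v k f = \<pi> v k g" if "v \<in> Od"
    "\<And>x. x \<in> Ev \<Longrightarrow> (\<And>u. u \<in> nb v \<Longrightarrow> lev x < lev u) \<Longrightarrow> f x = g x" for v k f g
    using that by (rule \<pi>_dep)
  show "\<kappa> v k u f = \<kappa> v k u g" if "v \<in> Od" "u \<in> nb v"
    "\<And>x. x \<in> Ev \<Longrightarrow> lev x < lev u \<Longrightarrow> f x = g x" for v k u f g
    using that by (rule \<kappa>_dep)
  show "kk v f \<in> Pow W \<times> Pow W" if "v \<in> Od" "f \<in> \<Omega>" for v f using kk_mem that by simp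
  show "0 < \<pi> v (kk v f) f" for v f using \<delta> by (simp add: \<pi>_def)
  show "0 < \<kappa> v (kk v f) u f (f u)" if "v \<in> Od" "f \<in> \<Omega>" "u \<in> nb v" for v f u
    using \<kappa>_kk_pos that by simp
qed

lemma \<Delta>_pos: "0 < \<Delta>" using \<Delta>_ge d_ge by linarith

text \<open>Announcing the candidate uniformly costs \<open>ln (4 ^ card W) / \<Delta>\<close>;
  uniform sampling from the image of \<open>nb v\<close> is then paid for by
  \<open>ln (eta H)\<close>.\<close>

lemma T_atypical:
  assumes f: "f \<in> \<Omega>" and v: "v \<in> V" and t: "\<not> typical v"
  shows "- (card W * ln 4 / \<Delta>) \<le> T v f"
proof -
  define S where "S = f ` nb v"
  have "- ln (card S) \<le> ln (\<kappa> v (kk v f) u f (f u))" if u: "u \<in> nb v" for u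
    using kern_bound(2)[of S "f u" l UNIV] finite_nb l_bounds u t by (simp add: \<kappa>_def kk_def S_def)
  then have "(\<Sum>u\<in>nb v. - ln (card S)) \<le> (\<Sum>u\<in>nb v. ln (\<kappa> v (kk v f) u f (f u)))" by (rule sum_mono)
  then have "- (\<Delta> * ln (card S)) \<le> (\<Sum>u\<in>nb v. ln (\<kappa> v (kk v f) u f (f u)))"
    using card_nb_\<Delta>[OF v] by simp
  moreover have "ln (\<pi> v (kk v f) f) = - (card W * ln 4)" using t by (simp add: \<pi>_def ln_div ln_realpow)
  ultimately have "(- (card W * ln 4) - \<Delta> * ln (card S)) / \<Delta> \<le> (ln (\<pi> v (kk v f) f) + (\<Sum>u\<in>nb v. ln (\<kappa> v (kk v f) u f (f u)))) / \<Delta>"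
    by (intro divide_right_mono) auto
  moreover have "(- (card W * ln 4) - \<Delta> * ln (card S)) / \<Delta> = - (card W * ln 4 / \<Delta>) - ln (card S)"
    using \<Delta>_pos by (simp add: field_simps)
  moreover have "ln (card S) + ln (card (cn S)) \<le> ln (eta H)"
    using ln_eta_ge[OF f v] by (simp add: S_def) (smt (verit) of_nat_0_le_iff zero_le_divide_iff of_bool_def)
  ultimately show ?thesis unfolding T_def S_def by linarith
qed

lemma ln_\<kappa>_typical:
  assumes f: "f \<in> \<Omega>" and v: "v \<in> V" and t: "typical v" and u: "u \<in> nb v"
  shows "- ln (card (f ` nb v)) + (if u \<in> D v then of_bool (f ` D v \<noteq> f ` nb v) / card W else 0)
    + (if u \<in> D' v then l / card W * of_bool (\<not> f ` nb v \<subseteq> f ` nb (dn (jj v) u))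
         - 2 * l * of_bool (pred v u f \<noteq> f ` nb (dn (jj v) u)) else 0)
    \<le> ln (\<kappa> v (kk v f) u f (f u))"
proof -
  define S where "S = f ` nb v"
  have S: "finite S" "f u \<in> S" using finite_nb u by (auto simp: S_def)
  have cS: "card S \<le> card W" "0 < card S" unfolding S_def using card_mono[OF finite_W image_nb_W[OF f]] image_nb_pos[OF f v] by auto
  have disj: "u \<in> D v \<Longrightarrow> u \<notin> D' v" using D_D'[OF v t] by auto
  consider "u \<in> D v" | "u \<in> D' v" "u \<notin> D v" | "u \<notin> D' v" "u \<notin> D v" using disj by auto
  then show ?thesis
  proof cases
    case 1
    have PS: "f ` D v \<subseteq> S" unfolding S_def by (rule image_mono[OF D_nb[OF v t]])
    have "- ln (card (f ` D v)) \<le> ln (kern l (f ` D v) UNIV (f u))"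
      using kern_bound(2)[of "f ` D v" "f u" l UNIV] finite_subset[OF PS S(1)] 1 l_bounds by simp
    moreover have "ln (card (f ` D v)) + of_bool (f ` D v \<noteq> S) / card W \<le> ln (card S)"
      using ln_card_subset[OF S(1) PS _ cS(1)] 1 by blast
    moreover have "\<kappa> v (kk v f) u f (f u) = kern l (f ` D v) UNIV (f u)" using 1 t by (simp add: \<kappa>_def kk_def)
    ultimately show ?thesis using 1 disj by (simp add: S_def)
  next
    case 2
    define v' where "v' = dn (jj v) u"
    have uV: "u \<in> V" using u nb_V by (rule subsetD[rotated])
    have v'V: "v' \<in> V" unfolding v'_def by (rule dn_V[OF uV idx(3)[OF t]])
    have "u \<in> nb v'" unfolding v'_def using dn_nb[OF uV idx(3)[OF t]] nb_sym by simp
    then have fu: "f u \<in> f ` nb v'" by simp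
    have "(\<lambda>i. dn i v') ` I v \<subseteq> nb v'"
      by (rule image_subsetI, rule dn_nb[OF v'V]) (use idx(1)[OF t] in auto)
    \<comment> \<open>The prediction can err only by missing values. Hence a failed inclusion into
      the true image is also one into \<open>pred v u f\<close>; and as \<open>f u\<close> lies in
      the true image, it is damped only if the prediction is incomplete.\<close>
    then have P: "pred v u f \<subseteq> f ` nb v'" unfolding pred_def v'_def[symmetric] by (rule image_mono)
    have "- ln (card S) + l / card S * of_bool (\<not> S \<subseteq> pred v u f) - 2 * l * of_bool (f u \<notin> pred v u f)
      \<le> ln (kern l S (pred v u f) (f u))" by (rule kern_bound(2)[OF S l_bounds])
    moreover have "l / card W * of_bool (\<not> S \<subseteq> f ` nb v') \<le> l / card S * of_bool (\<not> S \<subseteq> pred v u f)"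
      using P cS l_bounds by (intro mult_mono divide_left_mono) auto
    moreover have "2 * l * of_bool (f u \<notin> pred v u f) \<le> 2 * l * of_bool (pred v u f \<noteq> f ` nb v')"
      using fu l_bounds by (intro mult_left_mono) auto
    moreover have "\<kappa> v (kk v f) u f (f u) = kern l S (pred v u f) (f u)" using 2 t by (simp add: \<kappa>_def kk_def S_def)
    ultimately show ?thesis using 2 by (simp add: S_def v'_def)
  next
    case 3
    then show ?thesis using kern_bound(2)[of S "f u" l UNIV] S l_bounds by (simp add: \<kappa>_def kk_def S_def)
  qed
qed

lemma T_typical:
  assumes f: "f \<in> \<Omega>" and v: "v \<in> V" and t: "typical v"
  shows "of_bool (\<not> good (f ` nb v)) / eta H + (- 2 * \<delta>
      - \<Lambda> * (of_bool (f ` D v \<noteq> f ` nb v) + of_bool (f ` nb v \<noteq> f ` nb (fold dn (L v) v)))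
      + k0 / card W * of_bool (f ` D v \<noteq> f ` nb v)
      + (\<Sum>i\<in>J v. l / card W * of_bool (\<not> f ` nb v \<subseteq> f ` nb (dn (jj v) (dn i v)))
         - 2 * l * of_bool (pred v (dn i v) f \<noteq> f ` nb (dn (jj v) (dn i v))))) / \<Delta> \<le> T v f"
proof -
  define S where "S = f ` nb v"
  define y where "y = (of_bool (f ` D v \<noteq> S) :: real)"
  define z where "z = (of_bool (S \<noteq> f ` nb (fold dn (L v) v)) :: real)"
  define g where "g u = l / card W * of_bool (\<not> f ` nb v \<subseteq> f ` nb (dn (jj v) u))
         - 2 * l * of_bool (pred v u f \<noteq> f ` nb (dn (jj v) u))" for u
  have "(\<Sum>u\<in>nb v. - ln (card S) + (if u \<in> D v then y / card W else 0) + (if u \<in> D' v then g u else 0))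
    \<le> (\<Sum>u\<in>nb v. ln (\<kappa> v (kk v f) u f (f u)))"
    unfolding S_def y_def g_def by (rule sum_mono[OF ln_\<kappa>_typical[OF f v t]])
  also have "(\<Sum>u\<in>nb v. - ln (card S) + (if u \<in> D v then y / card W else 0) + (if u \<in> D' v then g u else 0))
    = - (\<Delta> * ln (card S)) + (\<Sum>u\<in>D v. y / card W) + (\<Sum>u\<in>D' v. g u)"
    unfolding sum.distrib using card_nb_\<Delta>[OF v] D_nb[OF v t] D'_nb[OF v t] finite_nb
    by (simp add: sum.inter_restrict[symmetric] Int_absorb1)
  also have "(\<Sum>u\<in>D v. y / card W) = k0 / card W * y" using card_D[OF v t] by simp
  also have "(\<Sum>u\<in>D' v. g u) = (\<Sum>i\<in>J v. g (dn i v))"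
    unfolding D'_def by (rule sum.reindex_cong[OF inj_on_subset[OF inj_dn[OF v] idx(2)[OF t]] refl refl])
  finally have \<kappa>: "- (\<Delta> * ln (card S)) + k0 / card W * y + (\<Sum>i\<in>J v. g (dn i v)) \<le> (\<Sum>u\<in>nb v. ln (\<kappa> v (kk v f) u f (f u)))" .
  \<comment> \<open>The announced pair is the predicted one exactly when \<open>y\<close> and
    \<open>z\<close> both vanish. Otherwise the cost is \<open>\<Lambda>\<close>, and
    \<open>y + z\<close> is at least 1.\<close>
  have \<pi>: "- 2 * \<delta> - \<Lambda> * (y + z) \<le> ln (\<pi> v (kk v f) f)"
  proof (cases "f ` D v = S \<and> S = f ` nb (fold dn (L v) v)")
    case True
    then have "\<pi> v (kk v f) f = 1 - \<delta>" using t by (simp add: \<pi>_def kk_def S_def)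
    moreover have "- \<delta> - 2 * \<delta>\<^sup>2 \<le> ln (1 - \<delta>)" using \<delta> by (intro ln_one_minus_pos_lower_bound) auto
    moreover have "2 * \<delta>\<^sup>2 \<le> \<delta>" using \<delta> mult_left_mono[of "2 * \<delta>" 1 \<delta>] by (simp add: power2_eq_square)
    ultimately show ?thesis using True by (simp add: y_def z_def)
  next
    case False
    then have "\<pi> v (kk v f) f = \<delta> / 4 ^ card W" using t by (auto simp: \<pi>_def kk_def S_def)
    then have "ln (\<pi> v (kk v f) f) = - \<Lambda>" using \<delta> by (simp add: \<Lambda>_def ln_div ln_realpow)
    moreover have "1 \<le> y + z" using False by (auto simp: y_def z_def)
    then have "\<Lambda> * 1 \<le> \<Lambda> * (y + z)" using \<Lambda>_nonneg by (rule mult_left_mono)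
    ultimately show ?thesis using \<delta> by simp
  qed
  have "(- 2 * \<delta> - \<Lambda> * (y + z) + k0 / card W * y + (\<Sum>i\<in>J v. g (dn i v)) - \<Delta> * ln (card S)) / \<Delta>
    \<le> (ln (\<pi> v (kk v f) f) + (\<Sum>u\<in>nb v. ln (\<kappa> v (kk v f) u f (f u)))) / \<Delta>"
    using \<kappa> \<pi> by (intro divide_right_mono) auto
  moreover have "(- 2 * \<delta> - \<Lambda> * (y + z) + k0 / card W * y + (\<Sum>i\<in>J v. g (dn i v)) - \<Delta> * ln (card S)) / \<Delta>
    = (- 2 * \<delta> - \<Lambda> * (y + z) + k0 / card W * y + (\<Sum>i\<in>J v. g (dn i v))) / \<Delta> - ln (card S)"
    using \<Delta>_pos by (simp add: diff_divide_distrib)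
  moreover note ln_eta_ge[OF f v]
  ultimately show ?thesis unfolding T_def g_def S_def y_def z_def by linarith
qed

text \<open>Let \<open>q = card W\<close>. By symmetry the bad events have counts
  \<open>\<beta>\<close>, \<open>Y\<close> and \<open>Z \<le> 2 * m * \<beta>\<close>. Half of the
  gain \<open>k0 / q * Y\<close> covers the damping losses and half covers
  \<open>\<Lambda> * Y\<close>; half of the gain \<open>k0 / (4 * q\<^sup>2) * \<beta>\<close>
  covers \<open>\<Lambda> * Z\<close>, and the other half remains.\<close>

lemma sum_T_typical:
  assumes v: "v \<in> V" and t: "typical v" and \<Lambda>: "16 * m * (card W)\<^sup>2 * \<Lambda> \<le> k0" and ne: "\<Omega> \<noteq> {}"
  shows "cnt (\<lambda>f. \<not> good (f ` nb v)) / eta H + (k0 / (8 * (card W)\<^sup>2) * \<beta> - 2 * \<delta> * card \<Omega>) / \<Delta>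
    \<le> (\<Sum>f\<in>\<Omega>. T v f)"
proof -
  define q where "q = real (card W)"
  define \<epsilon> where "\<epsilon> = real (cnt (\<lambda>f. \<not> good (f ` nb v)))"
  define Y where "Y = real (cnt (\<lambda>f. f ` D v \<noteq> f ` nb v))"
  define Z where "Z = real (cnt (\<lambda>f. f ` nb v \<noteq> f ` nb (fold dn (L v) v)))"
  obtain f where f: "f \<in> \<Omega>" using ne by blast
  have "W \<noteq> {}" using Hom_W[OF f v] by auto
  then have q: "1 \<le> q" using finite_W by (simp add: q_def Suc_leI card_gt_0_iff)
  have Z: "Z \<le> 2 * m * \<beta>"
    using of_nat_mono[where ?'a = real, OF cnt_fold_dn_ne[OF v L(1)[OF t] idx(4)[OF t] L(2)[OF t]]]
    unfolding Z_def of_nat_mult of_nat_numeral .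
  have J1: "real (cnt (\<lambda>f. \<not> f ` nb v \<subseteq> f ` nb (dn (jj v) (dn i v)))) = \<beta>" if "i \<in> J v" for i
    using cnt_dn_dn[OF v idx(3)[OF t], of i] idx(2)[OF t] jj[OF t] that by auto
  \<comment> \<open>The prediction uses the index set \<open>I v\<close> also at the lower vertex,
    so its failure is a translate of the event counted by \<open>Y\<close>.\<close>
  have J2: "real (cnt (\<lambda>f. pred v (dn i v) f \<noteq> f ` nb (dn (jj v) (dn i v)))) = Y" if "i \<in> J v" for i
  proof -
    have "i < d" using idx(2)[OF t] that by auto
    then have "dn (jj v) (dn i v) \<in> V" by (intro dn_V v idx(3)[OF t])
    from cnt_dn_translate[OF this v idx(1)[OF t]] show ?thesis unfolding Y_def pred_def D_def by simp
  qed
  define g where "g i f = l / q * of_bool (\<not> f ` nb v \<subseteq> f ` nb (dn (jj v) (dn i v)))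
         - 2 * l * of_bool (pred v (dn i v) f \<noteq> f ` nb (dn (jj v) (dn i v)))" for i f
  have "(\<Sum>f\<in>\<Omega>. \<Sum>i\<in>J v. g i f) = (\<Sum>i\<in>J v. \<Sum>f\<in>\<Omega>. g i f)" by (rule sum.swap)
  also have "\<dots> = (\<Sum>i\<in>J v. l / q * \<beta> - 2 * l * Y)"
    unfolding g_def sum_subtractf sum_distrib_left[symmetric] cnt_sum using J1 J2 by simp
  also have "\<dots> = k0 * (l / q * \<beta> - 2 * l * Y)" using card_J[OF t] by simp
  finally have g: "(\<Sum>f\<in>\<Omega>. \<Sum>i\<in>J v. g i f) = k0 * (l / q * \<beta> - 2 * l * Y)" .
  have "(\<Sum>f\<in>\<Omega>. of_bool (\<not> good (f ` nb v)) / eta H + (- 2 * \<delta>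
      - \<Lambda> * (of_bool (f ` D v \<noteq> f ` nb v) + of_bool (f ` nb v \<noteq> f ` nb (fold dn (L v) v)))
      + k0 / q * of_bool (f ` D v \<noteq> f ` nb v) + (\<Sum>i\<in>J v. g i f)) / \<Delta>) \<le> (\<Sum>f\<in>\<Omega>. T v f)"
    using T_typical[OF _ v t] unfolding g_def q_def by (intro sum_mono) simp
  moreover have "(\<Sum>f\<in>\<Omega>. of_bool (\<not> good (f ` nb v)) / eta H + (- 2 * \<delta>
      - \<Lambda> * (of_bool (f ` D v \<noteq> f ` nb v) + of_bool (f ` nb v \<noteq> f ` nb (fold dn (L v) v)))
      + k0 / q * of_bool (f ` D v \<noteq> f ` nb v) + (\<Sum>i\<in>J v. g i f)) / \<Delta>)
    = \<epsilon> / eta H + (- 2 * \<delta> * card \<Omega> - \<Lambda> * (Y + Z) + k0 / q * Y + k0 * (l / q * \<beta> - 2 * l * Y)) / \<Delta>"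
    by (simp only: sum.distrib sum_subtractf sum_divide_distrib[symmetric] sum_distrib_left[symmetric] cnt_sum g
        \<epsilon>_def Y_def Z_def sum_constant) (simp add: algebra_simps)
  moreover have "k0 / (8 * q\<^sup>2) * \<beta> - 2 * \<delta> * card \<Omega>
    \<le> - 2 * \<delta> * card \<Omega> - \<Lambda> * (Y + Z) + k0 / q * Y + k0 * (l / q * \<beta> - 2 * l * Y)"
  proof -
    have Y0: "0 \<le> Y" by (simp add: Y_def)
    have \<Lambda>1: "\<Lambda> \<le> k0 / (16 * m * q\<^sup>2)" using \<Lambda> q m_ge by (simp add: q_def field_simps)
    have "\<Lambda> * Y \<le> k0 / (2 * q) * Y"
    proof (rule mult_right_mono[OF order_trans[OF \<Lambda>1] Y0], rule divide_left_mono)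
      have "2 * q * 1 \<le> 16 * m * q\<^sup>2" unfolding power2_eq_square using q m_ge by (simp add: mult_mono')
      then show "2 * q \<le> 16 * m * q\<^sup>2" by simp
    qed (use q m_ge in auto)
    moreover have "\<Lambda> * Z \<le> k0 / (8 * q\<^sup>2) * \<beta>"
    proof -
      have "\<Lambda> * Z \<le> (k0 / (16 * m * q\<^sup>2)) * (2 * m * \<beta>)"
        using \<Lambda>1 Z \<Lambda>_nonneg by (intro mult_mono) (auto simp: Z_def)
      also have "\<dots> = k0 / (8 * q\<^sup>2) * \<beta>" using q m_ge by (simp add: field_simps)
      finally show ?thesis .
    qed
    moreover have "k0 * (l / q * \<beta> - 2 * l * Y) = k0 / (4 * q\<^sup>2) * \<beta> - k0 / (2 * q) * Y"
      using q by (simp add: l_def q_def[symmetric] field_simps power2_eq_square)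
    moreover have "k0 / (4 * q\<^sup>2) * \<beta> = k0 / (8 * q\<^sup>2) * \<beta> + k0 / (8 * q\<^sup>2) * \<beta>" "k0 / q * Y = k0 / (2 * q) * Y + k0 / (2 * q) * Y"
      using q by (simp_all add: field_simps)
    ultimately show ?thesis by (simp only: distrib_left)
  qed
  then have "(k0 / (8 * q\<^sup>2) * \<beta> - 2 * \<delta> * card \<Omega>) / \<Delta>
    \<le> (- 2 * \<delta> * card \<Omega> - \<Lambda> * (Y + Z) + k0 / q * Y + k0 * (l / q * \<beta> - 2 * l * Y)) / \<Delta>"
    by (rule divide_right_mono) simp
  ultimately show ?thesis by (simp only: \<epsilon>_def q_def of_nat_power of_nat_mult of_nat_numeral)
qed

text \<open>Translation invariance makes the lower bound the same at all typical vertices. Since the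
  total is at most 0, it cannot exceed what the atypical vertices lose.\<close>

lemma scheme_bound:
  assumes \<Lambda>: "16 * m * (card W)\<^sup>2 * \<Lambda> \<le> k0" and ne: "\<Omega> \<noteq> {}" and x: "x \<in> V"
  shows "card {v \<in> Od. typical v} * (cnt (\<lambda>f. \<not> good (f ` nb x)) / eta H + (k0 / (8 * (card W)\<^sup>2) * \<beta> - 2 * \<delta> * card \<Omega>) / \<Delta>)
    \<le> card {v \<in> Od. \<not> typical v} * (card W * ln 4 / \<Delta> * card \<Omega>)"
proof -
  have fin: "finite Od" using finite_V by simp
  have "(\<Sum>v\<in>Od. \<Sum>f\<in>\<Omega>. T v f) \<le> 0" using sum_T by (subst sum.swap)
  moreover have "(\<Sum>v\<in>Od. \<Sum>f\<in>\<Omega>. T v f) = (\<Sum>v\<in>{v \<in> Od. typical v}. \<Sum>f\<in>\<Omega>. T v f) + (\<Sum>v\<in>{v \<in> Od. \<not> typical v}. \<Sum>f\<in>\<Omega>. T v f)"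
    using sum.Int_Diff[OF fin, of _ "Collect typical"] by (simp only: Int_def Diff_eq Compl_eq mem_Collect_eq)
  moreover have "(\<Sum>v\<in>{v \<in> Od. typical v}. cnt (\<lambda>f. \<not> good (f ` nb x)) / eta H + (k0 / (8 * (card W)\<^sup>2) * \<beta> - 2 * \<delta> * card \<Omega>) / \<Delta>)
    \<le> (\<Sum>v\<in>{v \<in> Od. typical v}. \<Sum>f\<in>\<Omega>. T v f)"
  proof (rule sum_mono)
    fix v assume v: "v \<in> {v \<in> Od. typical v}"
    then have vV: "v \<in> V" and t: "typical v" by simp_all
    show "cnt (\<lambda>f. \<not> good (f ` nb x)) / eta H + (k0 / (8 * (card W)\<^sup>2) * \<beta> - 2 * \<delta> * card \<Omega>) / \<Delta> \<le> (\<Sum>f\<in>\<Omega>. T v f)"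
      using sum_T_typical[OF vV t \<Lambda> ne] cnt_nb_translate[OF x vV, of "\<lambda>S. \<not> good S"] by simp
  qed
  moreover have "(\<Sum>v\<in>{v \<in> Od. \<not> typical v}. \<Sum>f\<in>\<Omega>. - (card W * ln 4 / \<Delta>)) \<le> (\<Sum>v\<in>{v \<in> Od. \<not> typical v}. \<Sum>f\<in>\<Omega>. T v f)"
  proof (intro sum_mono)
    fix v f assume "v \<in> {v \<in> Od. \<not> typical v}" "f \<in> \<Omega>"
    then show "- (card W * ln 4 / \<Delta>) \<le> T v f" by (intro T_atypical) simp_all
  qed
  ultimately show ?thesis by (simp add: algebra_simps)
qed

end

section \<open>Defect probabilities\<close>

lemma card_Collect_compl: "finite A \<Longrightarrow> card {x \<in> A. P x} + card {x \<in> A. \<not> P x} = card A"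
  by (subst card_Un_disjoint[symmetric]) (auto intro!: arg_cong[where f = card])

context torus_homs
begin

text \<open>A coordinate of a uniform vertex is nonzero with probability \<open>1 - 1 / m\<close>,
  at least one half, so fewer than \<open>d / 16\<close> nonzero coordinates are exponentially
  unlikely.\<close>

lemma card_few_nonzero:
  "real (card {v \<in> V. 16 * card {i. i < d \<and> 0 < v i} < d}) \<le> (2 / 3) ^ d * real m ^ d"
proof -
  define nz where "nz v = card {i. i < d \<and> 0 < v i}" for v :: "nat \<Rightarrow> nat"
  define w where "w a = (if a = 0 then 1 else 1 / 16 :: real)" for a :: nat
  \<comment> \<open>an exponential moment bound\<close>
  have "1 \<le> (6 / 5) ^ d * (\<Prod>i<d. w (v i))" if "16 * nz v < d" for v
  proof -
    \<comment> \<open>The base satisfies \<open>16 \<le> (6 / 5) ^ 16\<close>, while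
      \<open>6 / 5 * 17 / 32\<close> stays below \<open>2 / 3\<close>.\<close>
    have "(16::real) ^ nz v \<le> ((6 / 5) ^ 16) ^ nz v" by (intro power_mono) (simp_all add: power_divide)
    also have "\<dots> = (6 / 5) ^ (16 * nz v)" by (simp add: power_mult)
    also have "\<dots> \<le> (6 / 5) ^ d" using that by (intro power_increasing) auto
    finally have "1 \<le> (6 / 5) ^ d * (1 / 16 :: real) ^ nz v" by (simp add: field_simps power_divide)
    moreover have "(\<Prod>i<d. w (v i)) = (1 / 16) ^ nz v"
    proof -
      have "(\<Prod>i<d. w (v i)) = (\<Prod>i\<in>{i. i < d \<and> 0 < v i}. 1 / 16)"
        by (rule prod.mono_neutral_cong_right) (auto simp: w_def)
      then show ?thesis by (simp add: nz_def)
    qed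
    ultimately show ?thesis by simp
  qed
  then have "(\<Sum>v\<in>{v \<in> V. 16 * nz v < d}. 1) \<le> (\<Sum>v\<in>{v \<in> V. 16 * nz v < d}. (6 / 5) ^ d * (\<Prod>i<d. w (v i)))"
    by (intro sum_mono) simp
  also have "\<dots> \<le> (\<Sum>v\<in>V. (6 / 5) ^ d * (\<Prod>i<d. w (v i)))"
  proof (rule sum_mono2[OF finite_V Collect_subset])
    show "0 \<le> (6 / 5) ^ d * (\<Prod>i<d. w (v i))" for v
      by (intro mult_nonneg_nonneg prod_nonneg) (simp_all add: w_def)
  qed
  also have "\<dots> = (6 / 5) ^ d * (\<Prod>i<d. \<Sum>a<m. w a)"
    by (subst prod_sum_PiE) (auto simp: sum_distrib_left)
  also have "\<dots> = (6 / 5) ^ d * (\<Sum>a<m. w a) ^ d" by simp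
  also have "\<dots> \<le> (6 / 5) ^ d * (17 / 32 * m) ^ d"
  proof (intro mult_left_mono power_mono)
    have "(\<Sum>a<m. w a) = 1 + (\<Sum>a\<in>{..<m} - {0}. w a)"
      using m_ge by (subst sum.remove[of _ 0]) (auto simp: w_def)
    also have "(\<Sum>a\<in>{..<m} - {0}. w a) = (\<Sum>a\<in>{..<m} - {0}. 1 / 16)" by (intro sum.cong) (auto simp: w_def)
    also have "\<dots> = (real m - 1) / 16" using m_ge by (simp add: of_nat_diff)
    \<comment> \<open>The worst case is \<open>m = 2\<close>, with equality.\<close>
    also have "1 + (real m - 1) / 16 \<le> 17 / 32 * m" using of_nat_mono[OF m_ge, where ?'a = real] by (simp add: field_simps)
    finally show "(\<Sum>a<m. w a) \<le> 17 / 32 * m" .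
  qed (auto simp: w_def intro!: sum_nonneg)
  also have "\<dots> = (51 / 80 * m) ^ d" by (simp flip: power_mult_distrib)
  also have "\<dots> \<le> (2 / 3 * m) ^ d" by (intro power_mono) auto
  also have "\<dots> = (2 / 3) ^ d * real m ^ d" by (rule power_mult_distrib)
  finally show ?thesis by (simp add: nz_def)
qed

text \<open>At least \<open>d / 16\<close> nonzero coordinates leave room for two disjoint sets of
  size \<open>d div 64\<close> and one further coordinate. The list \<open>L v\<close> may overlap
  these, so \<open>2 * m \<le> d / 16\<close> suffices for it.\<close>

lemma scheme_exists:
  assumes d: "64 \<le> d" "32 * m \<le> d" and \<delta>: "0 < \<delta>" "\<delta> \<le> 1 / 2"
  obtains I J jj L where
    "torus_scheme H m d (\<lambda>v. d \<le> 16 * card {i. i < d \<and> 0 < v i}) I J jj L (d div 64) \<delta>"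
proof -
  define k where "k = d div 64"
  define Q where "Q v = (\<lambda>(I, J, j, L). I \<union> J \<union> {j} \<union> set L \<subseteq> {i. i < d \<and> 0 < v i} \<and>
      card I = k \<and> card J = k \<and> I \<inter> J = {} \<and> j \<notin> I \<union> J \<and> distinct L \<and> length L = 2 * m)" for v :: "nat \<Rightarrow> nat"
  have "\<exists>p. Q v p"
    if v: "d \<le> 16 * card {i. i < d \<and> 0 < v i}" for v :: "nat \<Rightarrow> nat"
  proof -
    define P where "P = {i. i < d \<and> 0 < v i}"
    have P: "finite P" "2 * k + 1 \<le> card P" "2 * m \<le> card P" using v d by (auto simp: P_def k_def)
    obtain I where I: "I \<subseteq> P" "card I = k" using obtain_subset_with_card_n[of k P] P by auto
    have "k \<le> card (P - I)" using P I by (simp add: card_Diff_subset finite_subset[OF I(1)])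
    then obtain J where J: "J \<subseteq> P - I" "card J = k" using obtain_subset_with_card_n by metis
    have fin: "finite I" "finite J" using I J P finite_subset by blast+
    have "card (I \<union> J) \<le> 2 * k" using card_Un_le[of I J] I J by simp
    then have "\<not> P \<subseteq> I \<union> J" using card_mono[of "I \<union> J" P] fin P by auto
    then obtain j where j: "j \<in> P" "j \<notin> I \<union> J" by blast
    obtain S where S: "S \<subseteq> P" "card S = 2 * m" using obtain_subset_with_card_n[OF P(3)] by metis
    have finS: "finite S" using S P finite_subset by blast
    have "Q v (I, J, j, sorted_list_of_set S)"
      using I J j S finS by (auto simp: Q_def P_def)
    then show ?thesis by (rule exI)
  qed
  then have "\<forall>v. \<exists>p. d \<le> 16 * card {i. i < d \<and> 0 < v i} \<longrightarrow> Q v p" by blast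
  from choice[OF this] obtain F where F: "\<And>v. d \<le> 16 * card {i. i < d \<and> 0 < v i} \<Longrightarrow> Q v (F v)" by blast
  define I where "I v = fst (F v)" for v
  define J where "J v = fst (snd (F v))" for v
  define jj where "jj v = fst (snd (snd (F v)))" for v
  define L where "L v = snd (snd (snd (F v)))" for v
  have *: "I v \<union> J v \<union> {jj v} \<union> set (L v) \<subseteq> {i. i < d \<and> 0 < v i} \<and> card (I v) = k \<and> card (J v) = k \<and>
      I v \<inter> J v = {} \<and> jj v \<notin> I v \<union> J v \<and> distinct (L v) \<and> length (L v) = 2 * m"
    if "d \<le> 16 * card {i. i < d \<and> 0 < v i}" for v
    using F[OF that] by (simp add: Q_def I_def J_def jj_def L_def split_beta)
  have "torus_scheme H m d (\<lambda>v. d \<le> 16 * card {i. i < d \<and> 0 < v i}) I J jj L k \<delta>"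
    by unfold_locales (use * \<delta> in \<open>simp_all\<close>)
  then show ?thesis using that by (simp add: k_def)
qed

text \<open>The first term is \<open>2 * \<delta>\<close> for the \<open>\<delta>\<close> chosen in
  \<open>defect_bounds\<close>; the second bounds the expense of the atypical vertices relative to
  the number of typical ones.\<close>

definition R :: real where
  "R = 2 * exp (- (d / (4096 * m * (card W)\<^sup>2))) + 8 * card W * (2 / 3) ^ d"

lemma defect_bounds:
  assumes ne: "\<Omega> \<noteq> {}" and x: "x \<in> V" and d: "8192 * m * card W ^ 3 \<le> d"
  shows "real (cnt (\<lambda>f. \<not> good (f ` nb x))) \<le> eta H * R * card \<Omega>"
    and "real \<beta> \<le> 2048 * (card W)\<^sup>2 * R * card \<Omega>"
proof -
  define q where "q = card W"
  obtain f where f: "f \<in> \<Omega>" using ne by blast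
  have "W \<noteq> {}" using Hom_W[OF f x] by auto
  then have q: "1 \<le> q" using finite_W by (simp add: q_def Suc_leI card_gt_0_iff)
  then have q3: "1 \<le> q ^ 3" by simp
  have d1: "8192 * m \<le> d" using d q3 order_trans[of "8192 * m * 1" "8192 * m * q ^ 3" d] by (simp add: q_def)
  then have d2: "64 \<le> d" "32 * m \<le> d" "16384 \<le> d" using m_ge by linarith+
  \<comment> \<open>Exponentially small, yet \<open>- ln \<delta>\<close> contributes only
    \<open>d / 256\<close> to \<open>16 * m * q\<^sup>2 * \<Lambda>\<close>. The hypothesis on
    \<open>d\<close> bounds the remaining part by \<open>d / 256\<close> as well, and
    \<open>d / 128 \<le> d div 64\<close>.\<close>
  define \<delta> where "\<delta> = exp (- (d / (4096 * m * q\<^sup>2)))"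
  have dq: "real (8192 * m * q ^ 3) \<le> real d" using d unfolding q_def of_nat_le_iff .
  have "1 \<le> d / (4096 * m * q\<^sup>2)"
  proof -
    have "4096 * m * q\<^sup>2 \<le> 8192 * m * q ^ 3"
      using q by (intro mult_mono) (auto intro!: power_increasing)
    then have "real (4096 * m * q\<^sup>2) \<le> d" using dq by linarith
    then show ?thesis using q m_ge by (simp add: field_simps)
  qed
  then have "\<delta> \<le> exp (- 1)" unfolding \<delta>_def by simp
  also have "exp (- 1 :: real) \<le> 1 / 2"
    using exp_ge_add_one_self[of "1::real"] by (simp add: exp_minus field_simps)
  finally have \<delta>: "0 < \<delta>" "\<delta> \<le> 1 / 2" by (simp_all add: \<delta>_def)
  obtain I J jj L where sch: "torus_scheme H m d (\<lambda>v. d \<le> 16 * card {i. i < d \<and> 0 < v i}) I J jj L (d div 64) \<delta>"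
    using scheme_exists[OF d2(1,2) \<delta>] by blast
  interpret S: torus_scheme H m d "\<lambda>v. d \<le> 16 * card {i. i < d \<and> 0 < v i}" I J jj L "d div 64" \<delta>
    by (rule sch)
  define k where "k = real (d div 64)"
  have k: "d / 128 \<le> k" "0 < k" using d2 by (auto simp: k_def)
  have ln4: "ln (4::real) \<le> 2" using ln_realpow[of 2 2] ln_le_minus_one[of "2::real"] by simp
  have "16 * m * (card W)\<^sup>2 * S.\<Lambda> \<le> real (d div 64)"
  proof -
    have "S.\<Lambda> \<le> 2 * q + d / (4096 * m * q\<^sup>2)"
    proof -
      have "S.\<Lambda> = q * ln 4 - ln \<delta>" unfolding q_def by (rule S.\<Lambda>_def)
      moreover have "ln \<delta> = - (d / (4096 * m * q\<^sup>2))" by (simp add: \<delta>_def)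
      ultimately show ?thesis using mult_left_mono[OF ln4, of "real q"] by simp
    qed
    then have "16 * m * (real q)\<^sup>2 * S.\<Lambda> \<le> 16 * m * (real q)\<^sup>2 * (2 * q + d / (4096 * m * q\<^sup>2))"
      by (intro mult_left_mono) auto
    also have "\<dots> = 32 * m * real q ^ 3 + d / 256"
      using q m_ge by (simp add: field_simps power2_eq_square power3_eq_cube)
    also have "\<dots> \<le> d / 128" using dq by simp
    also have "\<dots> \<le> real (d div 64)" using k by (simp add: k_def)
    finally show ?thesis by (simp add: q_def)
  qed
  from S.scheme_bound[OF this ne x]
  have main: "card {v \<in> Od. d \<le> 16 * card {i. i < d \<and> 0 < v i}} *
      (cnt (\<lambda>f. \<not> good (f ` nb x)) / eta H + (k / (8 * q\<^sup>2) * \<beta> - 2 * \<delta> * card \<Omega>) / \<Delta>)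
    \<le> card {v \<in> Od. \<not> d \<le> 16 * card {i. i < d \<and> 0 < v i}} * (q * ln 4 / \<Delta> * card \<Omega>)"
    by (simp add: k_def q_def)
  define Nt where "Nt = real (card {v \<in> Od. d \<le> 16 * card {i. i < d \<and> 0 < v i}})"
  define Na where "Na = real (card {v \<in> Od. \<not> d \<le> 16 * card {i. i < d \<and> 0 < v i}})"
  define \<epsilon> where "\<epsilon> = real (cnt (\<lambda>f. \<not> good (f ` nb x)))"
  have md: "0 < real m ^ d" using m_ge by simp
  have Na: "Na \<le> (2 / 3) ^ d * real m ^ d"
  proof -
    have "card {v \<in> Od. \<not> d \<le> 16 * card {i. i < d \<and> 0 < v i}} \<le> card {v \<in> V. 16 * card {i. i < d \<and> 0 < v i} < d}"
    proof (rule card_mono)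
      show "finite {v \<in> V. 16 * card {i. i < d \<and> 0 < v i} < d}" using finite_V by simp
    qed (rule subsetI, simp)
    then show ?thesis unfolding Na_def using card_few_nonzero by linarith
  qed
  have sumN: "Nt + Na = real m ^ d / 2"
  proof -
    have "card {v \<in> Od. d \<le> 16 * card {i. i < d \<and> 0 < v i}} + card {v \<in> Od. \<not> d \<le> 16 * card {i. i < d \<and> 0 < v i}} = card Od"
      using card_Collect_compl[of Od] finite_V by simp
    then have "Nt + Na = real (card Od)" unfolding Nt_def Na_def by linarith
    moreover have "2 * real (card Od) = real m ^ d" 
      using arg_cong[OF card_Od, of real] by (simp only: of_nat_mult of_nat_numeral of_nat_power)
    ultimately show ?thesis by simp
  qed
  have "(2 / 3 :: real) ^ d \<le> (2 / 3) ^ 4" using d2 by (intro power_decreasing) auto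
  also have "\<dots> \<le> 1 / 4" by (simp add: power_divide)
  finally have "(2 / 3 :: real) ^ d \<le> 1 / 4" .
  then have "(2 / 3) ^ d * real m ^ d \<le> 1 / 4 * real m ^ d" using md by (intro mult_right_mono) auto
  \<comment> \<open>There are \<open>m ^ d / 2\<close> odd vertices, so at least half of them are
    typical.\<close>
  then have Nt: "real m ^ d / 4 \<le> Nt" using Na sumN by simp
  then have Nt0: "0 < Nt" using md by linarith
  have "Na \<le> 4 * (2 / 3) ^ d * Nt"
  proof -
    have "Na \<le> 4 * (2 / 3) ^ d * (real m ^ d / 4)" using Na by simp
    also have "\<dots> \<le> 4 * (2 / 3) ^ d * Nt" using Nt by (intro mult_left_mono) auto
    finally show ?thesis .
  qed
  then have "Na * (q * ln 4 / \<Delta> * card \<Omega>) \<le> 4 * (2 / 3) ^ d * Nt * (q * ln 4 / \<Delta> * card \<Omega>)"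
    by (intro mult_right_mono) auto
  with main have "Nt * (\<epsilon> / eta H + (k / (8 * q\<^sup>2) * \<beta> - 2 * \<delta> * card \<Omega>) / \<Delta>) \<le> Nt * (4 * (2 / 3) ^ d * (q * ln 4 / \<Delta> * card \<Omega>))"
    unfolding Nt_def Na_def \<epsilon>_def by (simp only: mult_ac)
  then have "\<epsilon> / eta H + (k / (8 * q\<^sup>2) * \<beta> - 2 * \<delta> * card \<Omega>) / \<Delta> \<le> 4 * (2 / 3) ^ d * (q * ln 4 / \<Delta> * card \<Omega>)"
    using Nt0 by (simp only: mult_le_cancel_left_pos)
  then have "\<epsilon> / eta H + k / (8 * q\<^sup>2) * \<beta> / \<Delta> \<le> (2 * \<delta> + 4 * (2 / 3) ^ d * (q * ln 4)) * card \<Omega> / \<Delta>"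
  proof -
    assume *: "\<epsilon> / eta H + (k / (8 * q\<^sup>2) * \<beta> - 2 * \<delta> * card \<Omega>) / \<Delta> \<le> 4 * (2 / 3) ^ d * (q * ln 4 / \<Delta> * card \<Omega>)"
    have "4 * (2 / 3) ^ d * (q * ln 4 / \<Delta> * card \<Omega>) = 4 * (2 / 3) ^ d * (q * ln 4) * card \<Omega> / \<Delta>" by simp
    then show ?thesis using * unfolding diff_divide_distrib distrib_right add_divide_distrib by linarith
  qed
  also have "\<dots> \<le> R * card \<Omega> / 1"
  proof (rule frac_le)
    have "(2 / 3) ^ d * (q * ln 4) \<le> (2 / 3) ^ d * (q * (2::real))" using ln4 by (intro mult_left_mono) auto
    then have "2 * \<delta> + 4 * (2 / 3) ^ d * (q * ln 4) \<le> R" unfolding R_def \<delta>_def q_def by simp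
    then show "(2 * \<delta> + 4 * (2 / 3) ^ d * (q * ln 4)) * card \<Omega> \<le> R * card \<Omega>" by (rule mult_right_mono) simp
    show "1 \<le> real \<Delta>" using S.\<Delta>_pos by simp
  qed (auto simp: R_def)
  finally have fin: "\<epsilon> / eta H + k / (8 * q\<^sup>2) * \<beta> / \<Delta> \<le> R * card \<Omega>" by simp
  have e0: "0 \<le> \<epsilon> / eta H" "0 \<le> k / (8 * q\<^sup>2) * \<beta> / \<Delta>" using k by (simp_all add: \<epsilon>_def)
  have "\<epsilon> / eta H \<le> R * card \<Omega>" using fin e0 by linarith
  then show "real (cnt (\<lambda>f. \<not> good (f ` nb x))) \<le> eta H * R * card \<Omega>"
    using eta_pos[OF ne] by (simp add: \<epsilon>_def field_simps)
  have "k / (8 * q\<^sup>2) * \<beta> / \<Delta> \<le> R * card \<Omega>" using fin e0 by linarith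
  then have "k * \<beta> \<le> 8 * q\<^sup>2 * \<Delta> * (R * card \<Omega>)" using q S.\<Delta>_pos by (simp add: field_simps)
  also have "\<dots> \<le> 8 * q\<^sup>2 * (256 * k) * (R * card \<Omega>)"
  proof -
    \<comment> \<open>The factor \<open>1 / \<Delta>\<close> in front of \<open>\<beta>\<close> is
      compensated by \<open>k\<close>, which is linear in \<open>d\<close>:
      \<open>\<Delta> \<le> 2 * d\<close> and \<open>d / 128 \<le> k\<close>.\<close>
    have "real \<Delta> \<le> 256 * k" using \<Delta>_le k by linarith
    then have "8 * (real q)\<^sup>2 * \<Delta> \<le> 8 * (real q)\<^sup>2 * (256 * k)" by (rule mult_left_mono) simp
    then show ?thesis by (intro mult_right_mono) (simp_all add: R_def)
  qed
  also have "\<dots> = k * (2048 * q\<^sup>2 * R * card \<Omega>)" by simp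
  finally show "real \<beta> \<le> 2048 * (card W)\<^sup>2 * R * card \<Omega>" using k by (simp add: q_def)
qed

text \<open>
  Given that \<open>f ` nb x = A\<close> for all \<open>x \<in> nb u\<close>, the values on \<open>nb u\<close> may be resampled freely in \<^term>\<open>cn A\<close>.
\<close>

lemma cnt_missing_value:
  assumes u: "u \<in> V" and b: "b \<in> cn A"
  shows "cnt (\<lambda>f. (\<forall>x\<in>nb u. f ` nb x = A) \<and> b \<notin> f ` nb u) \<le> (1 - 1 / card W) ^ d * card \<Omega>"
proof -
  define Bd where "Bd = {f \<in> \<Omega>. (\<forall>x\<in>nb u. f ` nb x = A) \<and> b \<notin> f ` nb u}"
  \<comment> \<open>The new values \<open>h\<close> overwrite \<open>f\<close> on
    \<open>nb u\<close> and the old values are kept alongside, so the map is injective. The old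
    values avoid \<open>b\<close>, which saves one choice at each neighbour.\<close>
  define \<Psi> :: "((nat \<Rightarrow> nat) \<Rightarrow> 'a) \<times> ((nat \<Rightarrow> nat) \<Rightarrow> 'a) \<Rightarrow> _" where
    "\<Psi> = (\<lambda>(f, h). (\<lambda>x. if x \<in> nb u then h x else f x, restrict f (nb u)))"
  have "card (Bd \<times> (nb u \<rightarrow>\<^sub>E cn A)) \<le> card (\<Omega> \<times> (nb u \<rightarrow>\<^sub>E (cn A - {b})))"
  proof (rule card_inj_on_le)
    show "inj_on \<Psi> (Bd \<times> (nb u \<rightarrow>\<^sub>E cn A))"
    proof (rule inj_onI, clarify)
      fix f h f' h' assume h: "h \<in> nb u \<rightarrow>\<^sub>E cn A" "h' \<in> nb u \<rightarrow>\<^sub>E cn A" and eq: "\<Psi> (f, h) = \<Psi> (f', h')"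
      have e1: "(if x \<in> nb u then h x else f x) = (if x \<in> nb u then h' x else f' x)" for x
        using eq unfolding \<Psi>_def by (simp add: fun_eq_iff)
      have e2: "restrict f (nb u) x = restrict f' (nb u) x" for x using eq unfolding \<Psi>_def by (simp add: fun_eq_iff)
      have "f x = f' x" for x using e1[of x] e2[of x] by (cases "x \<in> nb u") simp_all
      moreover have "h = h'" 
      proof (rule PiE_ext[OF h])
        show "h x = h' x" if "x \<in> nb u" for x using e1[of x] that by simp
      qed
      ultimately show "f = f' \<and> h = h'" by (simp add: fun_eq_iff)
    qed
    show "\<Psi> ` (Bd \<times> (nb u \<rightarrow>\<^sub>E cn A)) \<subseteq> \<Omega> \<times> (nb u \<rightarrow>\<^sub>E (cn A - {b}))"
    proof (rule image_subsetI, clarify)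
      fix f h assume f: "f \<in> Bd" and h: "h \<in> nb u \<rightarrow>\<^sub>E cn A"
      have fO: "f \<in> \<Omega>" and fA: "\<And>x. x \<in> nb u \<Longrightarrow> f ` nb x = A" and fb: "b \<notin> f ` nb u" using f by (simp_all add: Bd_def)
      define g where "g = (\<lambda>x. if x \<in> nb u then h x else f x)"
      have "g \<in> \<Omega>"
      proof (rule Hom_iff[THEN iffD2], intro conjI ballI)
        show "g \<in> V \<rightarrow>\<^sub>E W"
        proof (rule PiE_I)
          fix x assume x: "x \<in> V"
          show "g x \<in> W" using PiE_mem[OF h, of x] cn_W Hom_W[OF fO x] by (auto simp: g_def)
        next
          fix x assume x: "x \<notin> V"
          then have "x \<notin> nb u" using nb_V by blast
          then show "g x = undefined" using PiE_arb[OF Hom_PiE[OF fO] x] by (simp add: g_def)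
        qed
        fix x y assume x: "x \<in> V" and y: "y \<in> nb x"
        have yV: "y \<in> V" using y nb_V by (rule subsetD[rotated])
        consider "x \<in> nb u" "y \<in> nb u" | "x \<in> nb u" "y \<notin> nb u" | "x \<notin> nb u" "y \<in> nb u" | "x \<notin> nb u" "y \<notin> nb u" by blast
        then show "(g x, g y) \<in> parcs H"
        proof cases
          \<comment> \<open>Neighbours of \<open>u\<close> all have the same parity, so no two of
            them are adjacent.\<close>
          case 1
          then show ?thesis using lev_nb(3)[OF u] lev_nb(3)[OF x y] by blast
        next
          case 2
          have "h x \<in> cn A" using PiE_mem[OF h 2(1)] .
          moreover have "f y \<in> A" using fA[OF 2(1)] y by blast
          ultimately show ?thesis using 2 by (simp add: g_def cn_def parcs_sym)
        next
          case 3
          have "h y \<in> cn A" using PiE_mem[OF h 3(2)] .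
          moreover have "f x \<in> A" using fA[OF 3(2)] y nb_sym by blast
          ultimately show ?thesis using 3 by (simp add: g_def cn_def)
        next
          case 4
          then show ?thesis using Hom_arc[OF fO x y] by (simp add: g_def)
        qed
      qed
      moreover have "restrict f (nb u) \<in> nb u \<rightarrow>\<^sub>E (cn A - {b})"
      proof (rule restrict_PiE_iff[THEN iffD2], rule ballI)
        fix x assume x: "x \<in> nb u"
        then have "x \<in> V" using nb_V by (rule subsetD[rotated])
        then have "f x \<in> cn A" using Hom_cn[OF fO, of x] fA[OF x] by simp
        then show "f x \<in> cn A - {b}" using fb x by auto
      qed
      ultimately show "\<Psi> (f, h) \<in> \<Omega> \<times> (nb u \<rightarrow>\<^sub>E (cn A - {b}))" by (simp add: \<Psi>_def g_def)
    qed
    show "finite (\<Omega> \<times> (nb u \<rightarrow>\<^sub>E (cn A - {b})))"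
      using finite_\<Omega> finite_nb finite_cn by (intro finite_cartesian_product finite_PiE) auto
  qed
  then have "card Bd * card (cn A) ^ \<Delta> \<le> card \<Omega> * (card (cn A) - 1) ^ \<Delta>"
    using b card_nb_\<Delta>[OF u] finite_cn by (simp add: card_cartesian_product card_PiE finite_nb)
  then have le: "real (card Bd) * card (cn A) ^ \<Delta> \<le> card \<Omega> * real (card (cn A) - 1) ^ \<Delta>"
    by (metis of_nat_le_iff of_nat_mult of_nat_power)
  have c: "0 < card (cn A)" using b finite_cn by (metis card_gt_0_iff empty_iff)
  have cW: "card (cn A) \<le> card W" by (rule card_mono[OF finite_W cn_W])
  have r: "real (card (cn A) - 1) / card (cn A) \<le> 1 - 1 / card W"
  proof -
    have "real (card (cn A) - 1) / card (cn A) = 1 - 1 / card (cn A)" using c by (simp add: field_simps of_nat_diff)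
    moreover have "1 / real (card W) \<le> 1 / card (cn A)" using c cW by (intro divide_left_mono) auto
    ultimately show ?thesis by linarith
  qed
  have "real (card Bd) \<le> card \<Omega> * (real (card (cn A) - 1) / card (cn A)) ^ \<Delta>"
    using le c by (simp add: power_divide field_simps)
  also have "\<dots> \<le> card \<Omega> * (1 - 1 / card W) ^ \<Delta>"
    using r by (intro mult_left_mono power_mono) auto
  also have "\<dots> \<le> card \<Omega> * (1 - 1 / card W) ^ d"
    using c cW \<Delta>_ge by (intro mult_left_mono power_decreasing) auto
  finally show ?thesis by (simp add: cnt_def Bd_def mult.commute)
qed

text \<open>For \<open>i \<noteq> j\<close> the vertices \<open>up i u\<close> and
  \<open>dn j u\<close> differ by two steps in the same direction, the situation controlled by
  \<open>\<beta>\<close>. With at least three coordinates, such comparisons link all neighbours of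
  \<open>u\<close>, including \<open>up i u\<close> with \<open>dn i u\<close>.\<close>

lemma ideal_edgeI:
  assumes f: "f \<in> \<Omega>" and u: "u \<in> Ev" and v: "v \<in> nb u" and e: "e = (u, v) \<or> e = (v, u)"
    and good: "good (f ` nb v)"
    and same: "\<And>i j. i < d \<Longrightarrow> j < d \<Longrightarrow> i \<noteq> j \<Longrightarrow> f ` nb (up i u) = f ` nb (dn j u)"
    and full: "\<And>b. b \<in> cn (f ` nb v) \<Longrightarrow> (\<forall>x\<in>nb u. f ` nb x = f ` nb v) \<Longrightarrow> b \<in> f ` nb u"
  shows "ideal_edge m d H e f"
proof -
  have uV: "u \<in> V" using u by simp
  define F where "F i = f ` nb (up i u)" for i
  define G where "G i = f ` nb (dn i u)" for i
  have FG: "F i = G j" if "i < d" "j < d" "i \<noteq> j" for i j using same[OF that] by (simp add: F_def G_def)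
  have F: "F i = F 0" if "i < d" for i
  proof -
    define j :: nat where "j = (if i = 1 then 2 else 1)"
    have j: "j < d" "j \<noteq> i" "j \<noteq> 0" using d_ge by (auto simp: j_def)
    then show ?thesis using FG[of i j] FG[of 0 j] that by simp
  qed
  have G: "G i = F 0" if "i < d" for i
  proof -
    define j :: nat where "j = (if i = 1 then 2 else 1)"
    have j: "j < d" "j \<noteq> i" using d_ge by (auto simp: j_def)
    then show ?thesis using FG[of j i] F[of j] that by simp
  qed
  have "f ` nb x = F 0" if x: "x \<in> nb u" for x
  proof -
    obtain i where "i < d" "x = up i u \<or> x = dn i u" using x unfolding nb_eq[OF uV] by fastforce
    then show ?thesis using F[of i] G[of i] unfolding F_def G_def by metis
  qed
  then have all: "\<forall>x\<in>nb u. f ` nb x = f ` nb v" using v by simp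
  have "f ` nb u = cn (f ` nb v)"
  proof (intro equalityI subsetI)
    fix b assume "b \<in> f ` nb u"
    then obtain x where x: "b = f x" "x \<in> nb u" by (rule imageE)
    have "x \<in> V" using x(2) nb_V by (rule subsetD[rotated])
    then show "b \<in> cn (f ` nb v)" using Hom_cn[OF f, of x] all x by simp
  qed (use full all in blast)
  moreover have "(f ` nb v, cn (f ` nb v)) \<in> max_pairs H"
    using image_nb_W[OF f] cn_W fully_adjacent_cn good by (simp add: max_pairs_def good_def)
  ultimately show ?thesis
    unfolding ideal_edge_def even_class_eq using e u by blast
qed

text \<open>A union bound over three kinds of failure: the image of \<open>nb v\<close> is not good,
  two neighbours of \<open>u\<close> see different images, or all see the same image
  \<open>A\<close> but some value of \<open>cn A\<close> is missing on \<open>nb u\<close>.\<close>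

lemma cnt_not_ideal:
  assumes e: "e \<in> parcs (torus m d)" and ne: "\<Omega> \<noteq> {}" and d: "8192 * m * card W ^ 3 \<le> d"
  shows "cnt (\<lambda>f. \<not> ideal_edge m d H e f)
    \<le> (eta H * R + 4096 * (card W)\<^sup>2 * (real d)\<^sup>2 * R + 2 ^ card W * card W * (1 - 1 / card W) ^ d) * card \<Omega>"
proof -
  obtain u v where u: "u \<in> Ev" and v: "v \<in> nb u" and uv: "e = (u, v) \<or> e = (v, u)"
  proof -
    obtain x y where e': "e = (x, y)" by fastforce
    then have x: "x \<in> V" and y: "y \<in> nb x" using e by (auto simp: nbhd_def torus_def)
    have "y \<in> V" using y nb_V by (rule subsetD[rotated])
    then show ?thesis
      using that[of x y] that[of y x] x y e' lev_nb(3)[OF x y] nb_sym[of y x] by (cases "even (lev x)") simp_all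
  qed
  have uV: "u \<in> V" using u by simp
  have vV: "v \<in> V" using v nb_V by (rule subsetD[rotated])
  define \<Phi>1 where "\<Phi>1 f \<longleftrightarrow> \<not> good (f ` nb v)" for f :: "(nat \<Rightarrow> nat) \<Rightarrow> 'a"
  define \<Phi>2 :: "nat \<times> nat \<Rightarrow> ((nat \<Rightarrow> nat) \<Rightarrow> 'a) \<Rightarrow> bool" where
    "\<Phi>2 p f \<longleftrightarrow> fst p \<noteq> snd p \<and> f ` nb (up (fst p) u) \<noteq> f ` nb (dn (snd p) u)" for p f
  define \<Phi>3 :: "'a set \<times> 'a \<Rightarrow> ((nat \<Rightarrow> nat) \<Rightarrow> 'a) \<Rightarrow> bool" where
    "\<Phi>3 p f \<longleftrightarrow> snd p \<in> cn (fst p) \<and> (\<forall>x\<in>nb u. f ` nb x = fst p) \<and> snd p \<notin> f ` nb u" for p f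
  have "cnt (\<lambda>f. \<not> ideal_edge m d H e f)
    \<le> cnt (\<lambda>f. \<Phi>1 f \<or> (\<exists>p\<in>{..<d} \<times> {..<d}. \<Phi>2 p f) \<or> (\<exists>p\<in>Pow W \<times> W. \<Phi>3 p f))"
  proof (rule cnt_mono, rule ccontr)
    fix f assume f: "f \<in> \<Omega>" and ni: "\<not> ideal_edge m d H e f"
      and no: "\<not> (\<Phi>1 f \<or> (\<exists>p\<in>{..<d} \<times> {..<d}. \<Phi>2 p f) \<or> (\<exists>p\<in>Pow W \<times> W. \<Phi>3 p f))"
    have "ideal_edge m d H e f"
    proof (rule ideal_edgeI[OF f u v uv])
      show "good (f ` nb v)" using no by (simp add: \<Phi>1_def)
      show "f ` nb (up i u) = f ` nb (dn j u)" if "i < d" "j < d" "i \<noteq> j" for i j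
      proof -
        have "\<forall>p\<in>{..<d} \<times> {..<d}. \<not> \<Phi>2 p f" using no by simp
        then have "\<not> \<Phi>2 (i, j) f" using that(1,2) by simp
        then show ?thesis using that(3) by (simp add: \<Phi>2_def)
      qed
      show "b \<in> f ` nb u" if "b \<in> cn (f ` nb v)" "\<forall>x\<in>nb u. f ` nb x = f ` nb v" for b
      proof (rule ccontr)
        assume "b \<notin> f ` nb u"
        then have "\<Phi>3 (f ` nb v, b) f" using that by (simp add: \<Phi>3_def)
        moreover have "(f ` nb v, b) \<in> Pow W \<times> W" using image_nb_W[OF f] subsetD[OF cn_W that(1)] by simp
        ultimately show False using no by blast
      qed
    qed
    then show False using ni by simp
  qed
  also have "\<dots> \<le> cnt \<Phi>1 + (cnt (\<lambda>f. \<exists>p\<in>{..<d} \<times> {..<d}. \<Phi>2 p f) + cnt (\<lambda>f. \<exists>p\<in>Pow W \<times> W. \<Phi>3 p f))"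
    by (rule order_trans[OF cnt_disj add_left_mono[OF cnt_disj]])
  also have "\<dots> \<le> cnt \<Phi>1 + ((\<Sum>p\<in>{..<d} \<times> {..<d}. cnt (\<Phi>2 p)) + (\<Sum>p\<in>Pow W \<times> W. cnt (\<Phi>3 p)))"
    using finite_W by (intro add_left_mono add_mono cnt_Bex) auto
  finally have "real (cnt (\<lambda>f. \<not> ideal_edge m d H e f))
    \<le> cnt \<Phi>1 + ((\<Sum>p\<in>{..<d} \<times> {..<d}. real (cnt (\<Phi>2 p))) + (\<Sum>p\<in>Pow W \<times> W. real (cnt (\<Phi>3 p))))"
    by (simp only: of_nat_add[symmetric] of_nat_sum[symmetric] of_nat_le_iff)
  moreover have "cnt \<Phi>1 \<le> eta H * R * card \<Omega>"
    unfolding \<Phi>1_def by (rule defect_bounds(1)[OF ne vV d])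
  moreover have "(\<Sum>p\<in>{..<d} \<times> {..<d}. real (cnt (\<Phi>2 p))) \<le> (\<Sum>p\<in>{..<d} \<times> {..<d}. 4096 * (card W)\<^sup>2 * R * card \<Omega>)"
  proof (rule sum_mono)
    fix p assume p: "p \<in> {..<d} \<times> {..<d}"
    obtain i j where ij: "p = (i, j)" by fastforce
    have R0: "0 \<le> R" by (simp add: R_def)
    show "real (cnt (\<Phi>2 p)) \<le> 4096 * (card W)\<^sup>2 * R * card \<Omega>"
    proof (cases "i = j")
      case True
      then have "cnt (\<Phi>2 p) = 0" by (simp add: cnt_def \<Phi>2_def ij)
      then show ?thesis using R0 by simp
    next
      case False
      have i: "i < d" "j < d" using p ij by simp_all
      \<comment> \<open>Lowering \<open>up i u\<close> in \<open>i\<close> gives back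
        \<open>u\<close>, so \<open>dn j u\<close> arises from \<open>up i u\<close> by two
        lowerings.\<close>
      have "cnt (\<Phi>2 p) \<le> cnt (\<lambda>f. f ` nb (up i u) \<noteq> f ` nb (dn j (dn i (up i u))))"
        by (rule cnt_mono) (simp add: \<Phi>2_def ij dn_up[OF uV i(1)])
      also have "\<dots> \<le> 2 * \<beta>" using False i by (intro cnt_dn_dn_ne up_V[OF uV]) auto
      finally show ?thesis using defect_bounds(2)[OF ne vV d] by linarith
    qed
  qed
  moreover have "(\<Sum>p\<in>{..<d} \<times> {..<d}. 4096 * (card W)\<^sup>2 * R * card \<Omega>) = 4096 * (card W)\<^sup>2 * (real d)\<^sup>2 * R * card \<Omega>"
    by (simp add: power2_eq_square)
  moreover have "(\<Sum>p\<in>Pow W \<times> W. real (cnt (\<Phi>3 p))) \<le> (\<Sum>p\<in>Pow W \<times> W. (1 - 1 / card W) ^ d * card \<Omega>)"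
  proof (rule sum_mono)
    fix p assume p: "p \<in> Pow W \<times> W"
    have "W \<noteq> {}" using p by auto
    then have q: "1 \<le> card W" using finite_W by (simp add: Suc_leI card_gt_0_iff)
    show "real (cnt (\<Phi>3 p)) \<le> (1 - 1 / card W) ^ d * card \<Omega>"
    proof (cases "snd p \<in> cn (fst p)")
      case True
      then have "\<Phi>3 p = (\<lambda>f. (\<forall>x\<in>nb u. f ` nb x = fst p) \<and> snd p \<notin> f ` nb u)"
        by (simp add: \<Phi>3_def fun_eq_iff)
      then show ?thesis using cnt_missing_value[OF uV True] by simp
    next
      case False
      then have "cnt (\<Phi>3 p) = 0" by (simp add: cnt_def \<Phi>3_def)
      moreover have "0 \<le> 1 - 1 / real (card W)" using q by simp
      ultimately show ?thesis by simp
    qed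
  qed
  moreover have "(\<Sum>p\<in>Pow W \<times> W. (1 - 1 / card W) ^ d * card \<Omega>) = 2 ^ card W * card W * (1 - 1 / card W) ^ d * card \<Omega>"
    using finite_W by (simp add: card_cartesian_product card_Pow)
  ultimately show ?thesis by (simp only: distrib_right)
qed

end

section \<open>Exponential decay and the final estimate\<close>

lemma quadratic_times_geometric_le_powr:
  fixes \<rho> C :: real
  assumes "0 < \<rho>" "\<rho> < 1" "0 \<le> C"
  obtains c where "c > 0" "\<forall>\<^sub>F n in sequentially. C * (real n)\<^sup>2 * \<rho> ^ n \<le> 2 powr (- c * real n)"
proof
  \<comment> \<open>With \<open>\<rho> = t ^ 4\<close>, the factor \<open>t ^ (2 * n)\<close>
    absorbs the quadratic term and the other \<open>t ^ (2 * n)\<close> equals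
    \<open>2 powr (- c * n)\<close>.\<close>
  define t where "t = sqrt (sqrt \<rho>)"
  have "t\<^sup>2 = sqrt \<rho>" using assms by (simp add: t_def)
  then have "(t\<^sup>2)\<^sup>2 = \<rho>" using assms by simp
  then have "t ^ 4 = \<rho>" by (simp flip: power_mult)
  then have t: "0 < t" "t < 1" "t ^ 4 = \<rho>" using assms by (simp_all add: t_def)
  define c where "c = - log 2 (t\<^sup>2)"
  have t2: "0 < t\<^sup>2" "t\<^sup>2 < 1" using t by (simp_all add: power_less_one_iff)
  then show "c > 0" by (simp add: c_def)
  have "(\<lambda>n. real n * t ^ n) \<longlonglongrightarrow> 0" using powser_times_n_limit_0[of t] t by simp
  then have "(\<lambda>n. C * (real n * t ^ n)\<^sup>2) \<longlonglongrightarrow> C * 0\<^sup>2" by (intro tendsto_intros)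
  then have "\<forall>\<^sub>F n in sequentially. C * (real n * t ^ n)\<^sup>2 < 1" by (intro order_tendstoD(2)) auto
  then show "\<forall>\<^sub>F n in sequentially. C * (real n)\<^sup>2 * \<rho> ^ n \<le> 2 powr (- c * real n)"
  proof eventually_elim
    case (elim n)
    have "\<rho> ^ n = (t ^ n)\<^sup>2 * (t\<^sup>2) ^ n" unfolding t(3)[symmetric] by (simp flip: power_mult power_add add: mult.commute)
    then have "C * (real n)\<^sup>2 * \<rho> ^ n = C * (real n * t ^ n)\<^sup>2 * (t\<^sup>2) ^ n" by (simp add: power_mult_distrib)
    also have "\<dots> \<le> 1 * (t\<^sup>2) ^ n" using elim by (intro mult_right_mono) auto
    also have "\<dots> = (2 powr (- c)) powr real n" using t2 by (simp add: c_def powr_realpow)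
    also have "\<dots> = 2 powr (- c * real n)" by (simp add: powr_powr)
    finally show ?case .
  qed
qed

theorem theorem1p4:
  fixes H :: "'a pair_pre_digraph" and m :: nat
  assumes "pair_pseudo_graph H" and "even m" and "m \<ge> 2"
  shows "\<exists>c::real. c > 0 \<and> (\<exists>d\<^sub>0. \<forall>d\<ge>d\<^sub>0. \<forall>e \<in> parcs (torus m d).
    measure (uniform_count_measure (Hom (torus m d) H))
      {f \<in> Hom (torus m d) H. \<not> ideal_edge m d H e f} \<le> 2 powr (- c * real d))"
proof -
  define q where "q = card (pverts H)"
  \<comment> \<open>The slowest of three decay rates: that of \<open>\<delta>\<close>, that of the
    share of atypical vertices, and that of a missing value around \<open>u\<close>.\<close>
  define \<rho> where "\<rho> = Max {exp (- (1 / (4096 * m * q\<^sup>2))), 2 / 3, 1 - 1 / real (max 1 q)}"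
  \<comment> \<open>Collects the coefficients of all three failures, using
    \<open>1 \<le> d\<^sup>2\<close> for the terms without a quadratic factor.\<close>
  define C where "C = (eta H + 4096 * (real q)\<^sup>2) * (2 + 8 * q) + 2 ^ q * q"
  have \<rho>1: "exp (- (1 / (4096 * m * q\<^sup>2))) \<le> \<rho>" "2 / 3 \<le> \<rho>" "1 - 1 / real (max 1 q) \<le> \<rho>"
    unfolding \<rho>_def by (rule Max_ge; simp)+
  show ?thesis
  proof (cases "q = 0")
    \<comment> \<open>A target without vertices admits no homomorphism, so the measured set is empty
      and any rate works.\<close>
    case q0: True
    have "Hom (torus m d) H = {}" if "d \<ge> 3" for d
    proof -
      interpret torus_homs H m d by (rule torus_homs.intro) (use assms that in auto)
      show ?thesis using Hom_W[OF _ origin_V] finite_W q0 by (auto simp: q_def)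
    qed
    then show ?thesis by (intro exI[of _ 1] conjI exI[of _ 3]) auto
  next
    case False
    then have q: "1 \<le> q" by simp
    have \<rho>: "0 < \<rho>" "\<rho> < 1" using \<rho>1(2) q assms(3) by (auto simp: \<rho>_def)
    have C0: "0 \<le> C" by (simp add: C_def)
    obtain c where c: "c > 0" "\<forall>\<^sub>F n in sequentially. C * (real n)\<^sup>2 * \<rho> ^ n \<le> 2 powr (- c * real n)"
      using quadratic_times_geometric_le_powr[OF \<rho> C0] by blast
    then obtain d1 where d1: "\<And>n. n \<ge> d1 \<Longrightarrow> C * (real n)\<^sup>2 * \<rho> ^ n \<le> 2 powr (- c * real n)"
      by (auto simp: eventually_sequentially)
    have "measure (uniform_count_measure (Hom (torus m d) H)) {f \<in> Hom (torus m d) H. \<not> ideal_edge m d H e f}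
        \<le> 2 powr (- c * real d)"
      if d: "d \<ge> max d1 (max 3 (8192 * m * q ^ 3))" and e: "e \<in> parcs (torus m d)" for d e
    proof -
      interpret torus_homs H m d by (rule torus_homs.intro) (use assms d in auto)
      show ?thesis
      proof (cases "\<Omega> = {}")
        case False
        have "measure (uniform_count_measure \<Omega>) {f \<in> \<Omega>. \<not> ideal_edge m d H e f} = cnt (\<lambda>f. \<not> ideal_edge m d H e f) / card \<Omega>"
          unfolding cnt_def by (intro measure_uniform_count_measure finite_\<Omega>) simp
        also have "\<dots> \<le> eta H * R + 4096 * (real q)\<^sup>2 * (real d)\<^sup>2 * R + 2 ^ q * q * (1 - 1 / q) ^ d"
          using cnt_not_ideal[OF e False] d False finite_\<Omega>
          by (simp add: q_def pos_divide_le_eq card_gt_0_iff)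
        also have "\<dots> \<le> C * (real d)\<^sup>2 * \<rho> ^ d"
        proof -
          have d2: "1 \<le> (real d)\<^sup>2" using d by simp
          have "exp (- (d / (4096 * m * q\<^sup>2))) = exp (- (1 / (4096 * m * q\<^sup>2))) ^ d" by (simp flip: exp_of_nat_mult)
          also have "\<dots> \<le> \<rho> ^ d" using \<rho>1 by (intro power_mono) auto
          finally have "2 * exp (- (d / (4096 * m * q\<^sup>2))) \<le> 2 * \<rho> ^ d" by simp
          moreover have "8 * q * (2 / 3) ^ d \<le> 8 * q * \<rho> ^ d" using \<rho>1 by (intro mult_left_mono power_mono) auto
          ultimately have R: "R \<le> (2 + 8 * q) * \<rho> ^ d" by (simp add: R_def distrib_right flip: q_def)
          have p: "(1 - 1 / real q) ^ d \<le> \<rho> ^ d" using \<rho>1(3) q by (intro power_mono) (auto simp: max_def split: if_splits)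
          have R0: "0 \<le> R" by (simp add: R_def)
          have "eta H * R \<le> (real d)\<^sup>2 * (eta H * ((2 + 8 * q) * \<rho> ^ d))"
            using mult_mono[OF d2 mult_left_mono[OF R, of "real (eta H)"]] R0 by simp
          moreover have "4096 * (real q)\<^sup>2 * (real d)\<^sup>2 * R \<le> 4096 * (real q)\<^sup>2 * (real d)\<^sup>2 * ((2 + 8 * q) * \<rho> ^ d)"
            using R by (intro mult_left_mono) auto
          moreover have "2 ^ q * q * (1 - 1 / real q) ^ d \<le> (real d)\<^sup>2 * (2 ^ q * q * \<rho> ^ d)"
            using mult_mono[OF d2 mult_left_mono[OF p, of "2 ^ q * real q"]] q by simp
          moreover have "C * (real d)\<^sup>2 * \<rho> ^ d = (real d)\<^sup>2 * (eta H * ((2 + 8 * q) * \<rho> ^ d))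
            + 4096 * (real q)\<^sup>2 * (real d)\<^sup>2 * ((2 + 8 * q) * \<rho> ^ d) + (real d)\<^sup>2 * (2 ^ q * q * \<rho> ^ d)"
            by (simp add: C_def algebra_simps)
          ultimately show ?thesis by linarith
        qed
        also have "\<dots> \<le> 2 powr (- c * real d)" using d1 d by simp
        finally show ?thesis .
      qed simp
    qed
    then show ?thesis using c(1) by blast
  qed
qed

end
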